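(* Let $m,n$ be nonzero integers, $d=\gcd(m,n)$ and $G_{m,n}=\langle x,y\mid x^m=y^n\rangle$. The number of irreducible components of the $SL(2,\mathbb{C})$-character variety $X(G_{m,n})$ is $$\begin{cases}\dfrac{(|m|-1)(|n|-1)}{2}+\dfrac{d+1}{2} & \text{if } d \text{ is odd},\\[2mm] \dfrac{(|m|-1)(|n|-1)+1}{2}+\dfrac{d+2}{2} & \text{if } d \text{ is even},\end{cases}$$ where the first summand is the number of straight lines in $V(I_1)\cup V(I_2)$ and the second summand is the number of irreducible components of $V(I_3)$.
   Context: $X(G_{m,n})=\{(\operatorname{tr}\rho(x),\operatorname{tr}\rho(y),\operatorname{tr}\rho(xy))\mid \rho:G_{m,n}\to SL(2,\mathbb{C})\text{ a homomorphism}\}\subseteq\mathbb{C}^3$, an algebraic set. For an ideal $I\subseteq\mathbb{C}[X,Y,Z]$, $V(I)\subseteq\mathbb{C}^3$ is its zero set. Polynomials in $\mathbb{C}[T]$, defined for all $k\in\mathbb{Z}$ (recursions used in both directions): $f_0=2$, $f_1=T$, $f_k=Tf_{k-1}-f_{k-2}$; $s_0=0$, $s_1=s_2=1$, $s_3=T+1$, $s_k=Ts_{k-2}-s_{k-4}$; $\sigma_0=0$, $\sigma_1=\sigma_2=1$, $\sigma_3=T-1$, $\sigma_k=T\sigma_{k-2}-\sigma_{k-4}$. For $a,b\in\mathbb{Z}$, $F_{a,b}$ is the unique polynomial in $\mathbb{C}[X,Y,Z]$ with $F_{a,b}(\operatorname{tr}A,\operatorname{tr}B,\operatorname{tr}AB)=\operatorname{tr}(A^aB^{-b})$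 for all $A,B\in SL(2,\mathbb{C})$. $D=X^2+Y^2+Z^2-XYZ-4$, and $J=\langle F_{i,k}-F_{j,l}\mid i-j=m,\ k-l=n\rangle$ (so $V(J)=X(G_{m,n})$). $I_1=\langle s_m(X),s_n(Y)\rangle$; $I_2=\langle\sigma_m(X),\sigma_n(Y)\rangle$ if $m,n$ are odd, $\langle\sigma_m(X),f_{n/2}(Y)\rangle$ if $m$ is odd and $n$ even, $\langle f_{m/2}(X),\sigma_n(Y)\rangle$ if $m$ is even and $n$ odd, $\langle f_{m/2}(X),f_{n/2}(Y)\rangle$ if $m,n$ are even; $I_3=J+\langle D\rangle$. The irreducible components of $V(I_1)\cup V(I_2)$ are lines of the form $\{X=a,\ Y=b\}$; "straight lines in $V(I_1)\cup V(I_2)$" refers to these. *)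

theory Defs
  imports
    "HOL-Analysis.Analysis"
    "HOL-Algebra.Group"
    "HOL-Computational_Algebra.Polynomial"
    "HOL-Computational_Algebra.Fundamental_Theorem_Algebra"
begin


section \<open>Group presentations and the group \<open>\<langle>x, y | x\<^sup>m = y\<^sup>n\<rangle>\<close>\<close>

text \<open>A letter \<open>(g, True)\<close> stands for the generator \<open>g\<close>, and \<open>(g, False)\<close> for its formal inverse.\<close>

type_synonym 'g word = "('g \<times> bool) list"

inductive pres_eq :: "('g word \<times> 'g word) set \<Rightarrow> 'g word \<Rightarrow> 'g word \<Rightarrow> bool"
  for R :: "('g word \<times> 'g word) set" where
  pres_refl: "pres_eq R u u"
| pres_sym: "pres_eq R u v \<Longrightarrow> pres_eq R v u"
| pres_trans: "pres_eq R u v \<Longrightarrow> pres_eq R v w \<Longrightarrow> pres_eq R u w"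
| pres_append: "pres_eq R u u' \<Longrightarrow> pres_eq R v v' \<Longrightarrow> pres_eq R (u @ v) (u' @ v')"
| pres_cancel: "pres_eq R [(g, e), (g, \<not> e)] []"
| pres_rel: "(u, v) \<in> R \<Longrightarrow> pres_eq R u v"

definition pres_class :: "('g word \<times> 'g word) set \<Rightarrow> 'g word \<Rightarrow> 'g word set" where
  "pres_class R w = {v. pres_eq R w v}"

definition presented_group :: "('g word \<times> 'g word) set \<Rightarrow> 'g word set monoid" where
  "presented_group R =
     \<lparr>carrier = range (pres_class R),
      mult = (\<lambda>a b. \<Union>u\<in>a. \<Union>v\<in>b. pres_class R (u @ v)),
      one = pres_class R []\<rparr>"

lemma pres_class_eq_iff: "pres_class R u = pres_class R v \<longleftrightarrow> pres_eq R u v"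
  unfolding pres_class_def by (blast intro: pres_refl pres_sym pres_trans)

lemma presented_group_mult:
  "pres_class R u \<otimes>\<^bsub>presented_group R\<^esub> pres_class R v = pres_class R (u @ v)"
proof -
  have "pres_class R (u' @ v') = pres_class R (u @ v)"
    if "u' \<in> pres_class R u" "v' \<in> pres_class R v" for u' v'
    using that by (auto simp: pres_class_eq_iff) (auto simp: pres_class_def intro: pres_append pres_sym)
  moreover have "u \<in> pres_class R u" "v \<in> pres_class R v"
    by (auto simp: pres_class_def intro: pres_refl)
  ultimately have "(\<Union>u'\<in>pres_class R u. \<Union>v'\<in>pres_class R v. pres_class R (u' @ v')) = pres_class R (u @ v)"
    by blast
  then show ?thesis
    by (simp add: presented_group_def)
qed

lemma pres_eq_inverse_word:
  "pres_eq R (rev (map (\<lambda>(g, e). (g, \<not> e)) w) @ w) []"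
proof (induction w)
  case Nil
  show ?case by (simp add: pres_refl)
next
  case (Cons l w)
  obtain g e where l: "l = (g, e)" by fastforce
  let ?i = "\<lambda>w. rev (map (\<lambda>(g, e). (g, \<not> e)) w)"
  have "pres_eq R [(g, \<not> e), (g, e)] []"
    using pres_cancel[of R g "\<not> e"] by simp
  from pres_append[OF this pres_refl]
  have "pres_eq R ([(g, \<not> e), (g, e)] @ w) ([] @ w)" .
  from pres_append[OF pres_refl this]
  have "pres_eq R (?i w @ ([(g, \<not> e), (g, e)] @ w)) (?i w @ ([] @ w))" .
  then show ?case
    using Cons.IH by (auto simp: l intro: pres_trans)
qed

lemma group_presented_group: "group (presented_group R)"
proof (rule groupI)
  have car: "x \<in> carrier (presented_group R) \<longleftrightarrow> (\<exists>w. x = pres_class R w)" for x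
    by (auto simp: presented_group_def)
  have one: "\<one>\<^bsub>presented_group R\<^esub> = pres_class R []"
    by (simp add: presented_group_def)
  show "\<one>\<^bsub>presented_group R\<^esub> \<in> carrier (presented_group R)"
    by (auto simp: car one)
  fix x y z
  assume x: "x \<in> carrier (presented_group R)"
  show "\<one>\<^bsub>presented_group R\<^esub> \<otimes>\<^bsub>presented_group R\<^esub> x = x"
    using x by (auto simp: car one presented_group_mult)
  show "\<exists>y\<in>carrier (presented_group R). y \<otimes>\<^bsub>presented_group R\<^esub> x = \<one>\<^bsub>presented_group R\<^esub>"
  proof -
    obtain w where w: "x = pres_class R w" using x by (auto simp: car)
    let ?v = "rev (map (\<lambda>(g, e). (g, \<not> e)) w)"
    have "pres_class R ?v \<otimes>\<^bsub>presented_group R\<^esub> x = \<one>\<^bsub>presented_group R\<^esub>"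
      by (simp add: w one presented_group_mult pres_class_eq_iff pres_eq_inverse_word)
    then show ?thesis using car by blast
  qed
  assume y: "y \<in> carrier (presented_group R)"
  show "x \<otimes>\<^bsub>presented_group R\<^esub> y \<in> carrier (presented_group R)"
    using x y by (auto simp: car presented_group_mult)
  assume z: "z \<in> carrier (presented_group R)"
  show "x \<otimes>\<^bsub>presented_group R\<^esub> y \<otimes>\<^bsub>presented_group R\<^esub> z =
      x \<otimes>\<^bsub>presented_group R\<^esub> (y \<otimes>\<^bsub>presented_group R\<^esub> z)"
    using x y z by (auto simp: car presented_group_mult)
qed

datatype gens = GenX | GenY

definition word_pow :: "'g \<Rightarrow> int \<Rightarrow> 'g word" where
  "word_pow g k = replicate (nat \<bar>k\<bar>) (g, 0 \<le> k)"

definition G_rel :: "int \<Rightarrow> int \<Rightarrow> (gens word \<times> gens word) set" where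
  "G_rel m n = {(word_pow GenX m, word_pow GenY n)}"

definition G_mn :: "int \<Rightarrow> int \<Rightarrow> gens word set monoid" where
  "G_mn m n = presented_group (G_rel m n)"

definition G_x :: "int \<Rightarrow> int \<Rightarrow> gens word set" where
  "G_x m n = pres_class (G_rel m n) [(GenX, True)]"

definition G_y :: "int \<Rightarrow> int \<Rightarrow> gens word set" where
  "G_y m n = pres_class (G_rel m n) [(GenY, True)]"


section \<open>The character variety\<close>

definition SL2 :: "(complex^2^2) monoid" where
  "SL2 = \<lparr>carrier = {A. det A = 1}, mult = (**), one = mat 1\<rparr>"

lemma group_SL2: "group SL2"
proof (rule groupI)
  fix A assume "A \<in> carrier SL2"
  then have A: "det A = 1" by (simp add: SL2_def)
  then obtain B where B: "A ** B = mat 1" "B ** A = mat 1"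
    by (metis invertible_def invertible_det_nz zero_neq_one)
  then have "det B = 1"
    using A det_mul[of A B] by simp
  then show "\<exists>B\<in>carrier SL2. B \<otimes>\<^bsub>SL2\<^esub> A = \<one>\<^bsub>SL2\<^esub>"
    using B by (auto simp: SL2_def)
qed (auto simp: SL2_def det_mul matrix_mul_assoc)

type_synonym point3 = "complex \<times> complex \<times> complex"

definition char_variety :: "int \<Rightarrow> int \<Rightarrow> point3 set" where
  "char_variety m n =
     {(trace (\<rho> (G_x m n)), trace (\<rho> (G_y m n)), trace (\<rho> (G_x m n \<otimes>\<^bsub>G_mn m n\<^esub> G_y m n))) | \<rho>.
        \<rho> \<in> hom (G_mn m n) SL2}"


section \<open>Polynomials in three variables, ideals and algebraic sets\<close>

text \<open>\<open>\<complex>[X, Y, Z]\<close> is represented as \<open>\<complex>[X][Y][Z]\<close>, so \<open>Z\<close> is the outermost variable.\<close>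

type_synonym poly3 = "complex poly poly poly"

definition varX :: poly3 where "varX = [:[:[:0, 1:]:]:]"
definition varY :: poly3 where "varY = [:[:0, 1:]:]"
definition varZ :: poly3 where "varZ = [:0, 1:]"

definition const3 :: "complex \<Rightarrow> poly3" where "const3 c = [:[:[:c:]:]:]"

definition subst3 :: "complex poly \<Rightarrow> poly3 \<Rightarrow> poly3" where
  "subst3 p P = poly (map_poly const3 p) P"

definition eval3 :: "poly3 \<Rightarrow> point3 \<Rightarrow> complex" where
  "eval3 p = (\<lambda>(x, y, z). poly (poly (poly p [:[:z:]:]) [:y:]) x)"

text \<open>An ideal is a submodule of the ring over itself, so the ideal generated by a set is its span.\<close>

lemma module_mult: "module ((*) :: 'a::comm_ring_1 \<Rightarrow> 'a \<Rightarrow> 'a)"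
  by unfold_locales (simp_all add: algebra_simps)

abbreviation ideal_gen :: "'a::comm_ring_1 set \<Rightarrow> 'a set" where
  "ideal_gen S \<equiv> module.span (*) S"

definition zero_set :: "poly3 set \<Rightarrow> point3 set" where
  "zero_set I = {v. \<forall>p\<in>I. eval3 p v = 0}"

definition algebraic_set :: "point3 set \<Rightarrow> bool" where
  "algebraic_set W \<longleftrightarrow> (\<exists>S. W = zero_set S)"

definition irreducible_set :: "point3 set \<Rightarrow> bool" where
  "irreducible_set W \<longleftrightarrow> algebraic_set W \<and> W \<noteq> {} \<and>
     (\<forall>A B. algebraic_set A \<and> algebraic_set B \<and> W = A \<union> B \<longrightarrow> W = A \<or> W = B)"

definition irreducible_components :: "point3 set \<Rightarrow> point3 set set" where
  "irreducible_components W =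
     {C. irreducible_set C \<and> C \<subseteq> W \<and> (\<forall>C'. irreducible_set C' \<and> C \<subseteq> C' \<and> C' \<subseteq> W \<longrightarrow> C' = C)}"

definition straight_lines :: "point3 set \<Rightarrow> point3 set set" where
  "straight_lines W = {L \<in> irreducible_components W. \<exists>a b. L = {(x, y, z). x = a \<and> y = b}}"

lemma eval3_simps [simp]:
  "eval3 varX (x, y, z) = x" "eval3 varY (x, y, z) = y" "eval3 varZ (x, y, z) = z"
  "eval3 (const3 c) v = c" "eval3 0 v = 0" "eval3 1 v = 1" "eval3 2 v = 2" "eval3 4 v = 4"
  "eval3 (p + q) v = eval3 p v + eval3 q v"
  "eval3 (p - q) v = eval3 p v - eval3 q v"
  "eval3 (p * q) v = eval3 p v * eval3 q v"
  "eval3 (p ^ k) v = eval3 p v ^ k"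
  by (auto simp: eval3_def varX_def varY_def varZ_def const3_def split: prod.splits)

lemma eval3_subst3: "eval3 (subst3 p P) v = poly p (eval3 P v)"
proof (induction p)
  case (pCons a p)
  have "map_poly const3 (pCons a p) = pCons (const3 a) (map_poly const3 p)"
    by (rule map_poly_pCons) (simp add: const3_def)
  with pCons show ?case by (simp add: subst3_def)
qed (simp add: subst3_def)

lemma eval3_eq_0_imp:
  assumes "\<And>v. eval3 p v = 0"
  shows "p = 0"
proof -
  have univ: "q = 0" if "\<And>t. poly q [:t:] = 0" for q :: "'a::field_char_0 poly poly"
  proof (rule ccontr)
    assume "q \<noteq> 0"
    then have "finite {t. poly q t = 0}" by (rule poly_roots_finite)
    moreover have "range (\<lambda>t. [:t:]) \<subseteq> {t. poly q t = 0}" using that by auto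
    ultimately have "finite (range (\<lambda>t::'a. [:t:]))" by (rule finite_subset[rotated])
    moreover have "inj (\<lambda>t::'a. [:t:])" by (auto simp: inj_def)
    ultimately show False using infinite_UNIV_char_0 finite_imageD by blast
  qed
  have z: "poly p [:[:z:]:] = 0" for z
  proof (rule univ)
    fix y
    have "poly (poly (poly p [:[:z:]:]) [:y:]) x = 0" for x
      using assms[of "(x, y, z)"] by (simp add: eval3_def)
    then show "poly (poly p [:[:z:]:]) [:y:] = 0"
      using poly_all_0_iff_0 by blast
  qed
  show ?thesis
  proof (rule ccontr)
    assume "p \<noteq> 0"
    then have "finite {t. poly p t = 0}" by (rule poly_roots_finite)
    moreover have "range (\<lambda>t. [:[:t:]:]) \<subseteq> {t. poly p t = 0}" using z by auto
    ultimately have "finite (range (\<lambda>t::complex. [:[:t:]:]))" by (rule finite_subset[rotated])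
    moreover have "inj (\<lambda>t::complex. [:[:t:]:])" by (auto simp: inj_def)
    ultimately show False using infinite_UNIV_char_0 finite_imageD by blast
  qed
qed


section \<open>The polynomials \<open>f\<^sub>k\<close>, \<open>s\<^sub>k\<close>, \<open>\<sigma>\<^sub>k\<close>\<close>

abbreviation varT :: "complex poly" where "varT \<equiv> [:0, 1:]"

text \<open>Negative indices are reached by solving the recursion for its last term;
  that the recursions hold for all integers is shown below.\<close>

function f_poly :: "int \<Rightarrow> complex poly" where
  "f_poly k =
     (if k = 0 then 2
      else if k = 1 then varT
      else if k > 1 then varT * f_poly (k - 1) - f_poly (k - 2)
      else varT * f_poly (k + 1) - f_poly (k + 2))"
  by pat_completeness auto
termination by (relation "Wellfounded.measure (\<lambda>k. nat \<bar>2 * k - 1\<bar>)") auto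

function s_poly :: "int \<Rightarrow> complex poly" where
  "s_poly k =
     (if k = 0 then 0
      else if k = 1 \<or> k = 2 then 1
      else if k = 3 then varT + 1
      else if k > 3 then varT * s_poly (k - 2) - s_poly (k - 4)
      else varT * s_poly (k + 2) - s_poly (k + 4))"
  by pat_completeness auto
termination by (relation "Wellfounded.measure (\<lambda>k. nat \<bar>2 * k - 3\<bar>)") auto

function sigma_poly :: "int \<Rightarrow> complex poly" where
  "sigma_poly k =
     (if k = 0 then 0
      else if k = 1 \<or> k = 2 then 1
      else if k = 3 then varT - 1
      else if k > 3 then varT * sigma_poly (k - 2) - sigma_poly (k - 4)
      else varT * sigma_poly (k + 2) - sigma_poly (k + 4))"
  by pat_completeness auto
termination by (relation "Wellfounded.measure (\<lambda>k. nat \<bar>2 * k - 3\<bar>)") auto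

declare f_poly.simps [simp del] s_poly.simps [simp del] sigma_poly.simps [simp del]

lemma f_poly_base: "f_poly 0 = 2" "f_poly 1 = varT"
  by (subst f_poly.simps, simp)+

lemma s_poly_base: "s_poly 0 = 0" "s_poly 1 = 1" "s_poly 2 = 1" "s_poly 3 = varT + 1"
  by (subst s_poly.simps, simp)+

lemma sigma_poly_base:
  "sigma_poly 0 = 0" "sigma_poly 1 = 1" "sigma_poly 2 = 1" "sigma_poly 3 = varT - 1"
  by (subst sigma_poly.simps, simp)+

lemma f_poly_rec: "f_poly k = varT * f_poly (k - 1) - f_poly (k - 2)"
proof (cases "k > 1")
  case True
  then show ?thesis by (subst f_poly.simps) simp
next
  case False
  then have "f_poly (k - 2) = varT * f_poly (k - 1) - f_poly k"
    by (subst f_poly.simps) (simp add: algebra_simps)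
  then show ?thesis by simp
qed

lemma s_poly_rec: "s_poly k = varT * s_poly (k - 2) - s_poly (k - 4)"
proof (cases "k > 3")
  case True
  then show ?thesis by (subst s_poly.simps) simp
next
  case False
  then have "s_poly (k - 4) = varT * s_poly (k - 2) - s_poly k"
    by (subst s_poly.simps) (simp add: algebra_simps)
  then show ?thesis by simp
qed

lemma sigma_poly_rec: "sigma_poly k = varT * sigma_poly (k - 2) - sigma_poly (k - 4)"
proof (cases "k > 3")
  case True
  then show ?thesis by (subst sigma_poly.simps) simp
next
  case False
  then have "sigma_poly (k - 4) = varT * sigma_poly (k - 2) - sigma_poly k"
    by (subst sigma_poly.simps) (simp add: algebra_simps)
  then show ?thesis by simp
qed


section \<open>The trace polynomials \<open>F\<^sub>a\<^sub>,\<^sub>b\<close>\<close>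

definition is_trace_poly :: "int \<Rightarrow> int \<Rightarrow> poly3 \<Rightarrow> bool" where
  "is_trace_poly a b p \<longleftrightarrow>
     (\<forall>A\<in>carrier SL2. \<forall>B\<in>carrier SL2.
        eval3 p (trace A, trace B, trace (A \<otimes>\<^bsub>SL2\<^esub> B)) =
        trace ((A [^]\<^bsub>SL2\<^esub> a) \<otimes>\<^bsub>SL2\<^esub> (B [^]\<^bsub>SL2\<^esub> (- b))))"

definition F_poly :: "int \<Rightarrow> int \<Rightarrow> poly3" where
  "F_poly a b = (THE p. is_trace_poly a b p)"

lemma trace_surj:
  "\<exists>A\<in>carrier SL2. \<exists>B\<in>carrier SL2. (trace A, trace B, trace (A \<otimes>\<^bsub>SL2\<^esub> B)) = (x, y, z)"
proof -
  have "\<not> constant (poly [:1, - z, 1:])"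
  proof -
    have "poly [:1, - z, 1:] (if z = 1 then - 1 else 1) \<noteq> poly [:1, - z, 1:] 0"
      by (auto simp: algebra_simps)
    then show ?thesis unfolding constant_def by blast
  qed
  then obtain w where "poly [:1, - z, 1:] w = 0"
    using fundamental_theorem_of_algebra by blast
  then have w: "1 + w * w = z * w" by (simp add: algebra_simps)
  then have w0: "w \<noteq> 0" by auto
  define A :: "complex^2^2" where "A = vector [vector [x, -1], vector [1, 0]]"
  define B :: "complex^2^2" where "B = vector [vector [0, w], vector [- 1 / w, y]]"
  have "det A = 1" "det B = 1" "trace A = x" "trace B = y"
    using w0 by (simp_all add: A_def B_def det_2 trace_def sum_2)
  moreover have "trace (A ** B) = z"
    using w w0
    by (simp add: A_def B_def trace_def matrix_matrix_mult_def sum_2 field_simps)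
  ultimately show ?thesis
    unfolding SL2_def by fastforce
qed

lemma trace_poly_unique: "is_trace_poly a b p \<Longrightarrow> is_trace_poly a b q \<Longrightarrow> p = q"
proof -
  assume p: "is_trace_poly a b p" and q: "is_trace_poly a b q"
  have "eval3 (p - q) v = 0" for v
  proof -
    obtain x y z where v: "v = (x, y, z)" by (cases v)
    obtain A B where AB: "A \<in> carrier SL2" "B \<in> carrier SL2"
      "(trace A, trace B, trace (A \<otimes>\<^bsub>SL2\<^esub> B)) = v"
      using trace_surj[of x y z] v by blast
    show ?thesis
      using p q AB unfolding is_trace_poly_def by (metis eval3_simps(10) right_minus_eq)
  qed
  then show "p = q" using eval3_eq_0_imp[of "p - q"] by simp
qed

lemma SL2_cayley_hamilton:
  assumes "A \<in> carrier SL2"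
  shows "trace ((A ** A) ** M) = trace A * trace (A ** M) - trace M"
proof -
  have "A$1$1 * A$2$2 - A$1$2 * A$2$1 = 1"
    using assms by (simp add: SL2_def det_2)
  then show ?thesis
    by (simp add: trace_def matrix_matrix_mult_def sum_2) algebra
qed

lemma SL2_trace_pow_rec:
  assumes "A \<in> carrier SL2" "M \<in> carrier SL2"
  shows "trace (A [^]\<^bsub>SL2\<^esub> (k::int) \<otimes>\<^bsub>SL2\<^esub> M) =
    trace A * trace (A [^]\<^bsub>SL2\<^esub> (k - 1) \<otimes>\<^bsub>SL2\<^esub> M) - trace (A [^]\<^bsub>SL2\<^esub> (k - 2) \<otimes>\<^bsub>SL2\<^esub> M)"
proof -
  interpret SL2: group SL2 by (rule group_SL2)
  let ?P = "A [^]\<^bsub>SL2\<^esub> (k - 2)"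
  have 1: "A [^]\<^bsub>SL2\<^esub> (k - 1) = A \<otimes>\<^bsub>SL2\<^esub> ?P"
    using SL2.int_pow_mult[OF assms(1), of 1 "k - 2"] assms by (simp add: SL2.int_pow_1)
  have 2: "A [^]\<^bsub>SL2\<^esub> k = A \<otimes>\<^bsub>SL2\<^esub> (A [^]\<^bsub>SL2\<^esub> (k - 1))"
    using SL2.int_pow_mult[OF assms(1), of 1 "k - 1"] assms by (simp add: SL2.int_pow_1)
  have m: "(\<otimes>\<^bsub>SL2\<^esub>) = (**)" by (simp add: SL2_def)
  show ?thesis
    using SL2_cayley_hamilton[OF assms(1), of "?P ** M"]
    unfolding 2 1 m by (simp add: matrix_mul_assoc)
qed

lemma int_two_step_induct:
  fixes P :: "int \<Rightarrow> bool"
  assumes "P 0" "P 1" "\<And>k. P (k - 1) \<Longrightarrow> P (k - 2) \<Longrightarrow> P k" "\<And>k. P (k + 1) \<Longrightarrow> P (k + 2) \<Longrightarrow> P k"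
  shows "P k"
proof -
  have "P k \<and> P (k + 1)"
  proof (induction k rule: int_induct[where k = 0])
    case (step1 i)
    then show ?case using assms(3)[of "i + 2"] by (simp add: add.commute)
  next
    case (step2 i)
    then show ?case using assms(4)[of "i - 1"] by (simp add: add.commute)
  qed (use assms(1,2) in auto)
  then show ?thesis by simp
qed

lemma trace_poly_exists: "\<exists>p. is_trace_poly a b p"
proof -
  interpret SL2: group SL2 by (rule group_SL2)
  have comm: "trace (A \<otimes>\<^bsub>SL2\<^esub> B) = trace (B \<otimes>\<^bsub>SL2\<^esub> A)" for A B
    by (simp add: SL2_def, rule trace_mul_sym)
  define t where "t A B a c = trace (A [^]\<^bsub>SL2\<^esub> a \<otimes>\<^bsub>SL2\<^esub> B [^]\<^bsub>SL2\<^esub> c)"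
    for A B and a c :: int
  have recA: "t A B a c = trace A * t A B (a - 1) c - t A B (a - 2) c"
    if "A \<in> carrier SL2" "B \<in> carrier SL2" for A B a c
    unfolding t_def by (rule SL2_trace_pow_rec[OF that(1) SL2.int_pow_closed[OF that(2)]])
  have recA': "t A B a c = trace A * t A B (a + 1) c - t A B (a + 2) c"
    if "A \<in> carrier SL2" "B \<in> carrier SL2" for A B a c
  proof -
    show ?thesis using recA[OF that, of "a + 2" c] by (simp add: add.commute)
  qed
  have recB: "t A B a c = trace B * t A B a (c - 1) - t A B a (c - 2)"
    if "A \<in> carrier SL2" "B \<in> carrier SL2" for A B a c
  proof -
    have "t A B a c = trace (B [^]\<^bsub>SL2\<^esub> c \<otimes>\<^bsub>SL2\<^esub> A [^]\<^bsub>SL2\<^esub> a)" for c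
      unfolding t_def by (rule comm)
    then show ?thesis
      using SL2_trace_pow_rec[OF that(2) SL2.int_pow_closed[OF that(1)], of c a] by simp
  qed
  have recB': "t A B a c = trace B * t A B a (c + 1) - t A B a (c + 2)"
    if "A \<in> carrier SL2" "B \<in> carrier SL2" for A B a c
  proof -
    show ?thesis using recB[OF that, of a "c + 2"] by (simp add: add.commute)
  qed
  define T where "T p a c \<longleftrightarrow> (\<forall>A\<in>carrier SL2. \<forall>B\<in>carrier SL2.
      eval3 p (trace A, trace B, trace (A \<otimes>\<^bsub>SL2\<^esub> B)) = t A B a c)" for p a c
  have stepA: "T (varX * p - q) a c" if "T p (a - 1) c" "T q (a - 2) c" for p q a c
    using that by (simp add: T_def flip: recA)
  have stepA': "T (varX * p - q) a c" if "T p (a + 1) c" "T q (a + 2) c" for p q a c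
    using that by (simp add: T_def flip: recA')
  have stepB: "T (varY * p - q) a c" if "T p a (c - 1)" "T q a (c - 2)" for p q a c
    using that by (simp add: T_def flip: recB)
  have stepB': "T (varY * p - q) a c" if "T p a (c + 1)" "T q a (c + 2)" for p q a c
    using that by (simp add: T_def flip: recB')
  have tr1: "trace \<one>\<^bsub>SL2\<^esub> = 2" by (simp add: SL2_def trace_I)
  have base: "T 2 0 0" "T varX 1 0" "T varY 0 1" "T varZ 1 1"
    by (auto simp: T_def t_def tr1 SL2.int_pow_1)
  have 0: "\<exists>p. T p 0 c" for c
    by (induction c rule: int_two_step_induct) (use base stepB stepB' in blast)+
  have 1: "\<exists>p. T p 1 c" for c
    by (induction c rule: int_two_step_induct) (use base stepB stepB' in blast)+
  have "\<exists>p. T p a c" for a c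
    by (induction a rule: int_two_step_induct) (use 0 1 stepA stepA' in blast)+
  then show ?thesis unfolding T_def t_def is_trace_poly_def by blast
qed

lemma F_poly: "is_trace_poly a b (F_poly a b)"
  unfolding F_poly_def using trace_poly_exists trace_poly_unique by (metis theI)


section \<open>The ideals\<close>

definition D_poly :: poly3 where
  "D_poly = varX\<^sup>2 + varY\<^sup>2 + varZ\<^sup>2 - varX * varY * varZ - 4"

definition J_ideal :: "int \<Rightarrow> int \<Rightarrow> poly3 set" where
  "J_ideal m n = ideal_gen {F_poly i k - F_poly j l | i j k l. i - j = m \<and> k - l = n}"

definition I1_ideal :: "int \<Rightarrow> int \<Rightarrow> poly3 set" where
  "I1_ideal m n = ideal_gen {subst3 (s_poly m) varX, subst3 (s_poly n) varY}"

definition I2_ideal :: "int \<Rightarrow> int \<Rightarrow> poly3 set" where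
  "I2_ideal m n = ideal_gen
     {subst3 (if odd m then sigma_poly m else f_poly (m div 2)) varX,
      subst3 (if odd n then sigma_poly n else f_poly (n div 2)) varY}"

definition I3_ideal :: "int \<Rightarrow> int \<Rightarrow> poly3 set" where
  "I3_ideal m n = {p + q | p q. p \<in> J_ideal m n \<and> q \<in> ideal_gen {D_poly}}"

end

theory Submission
  imports Defs "HOL-Complex_Analysis.Conformal_Mappings"
begin

text \<open>
  By the universal property of the presentation, the character variety consists of the points
  \<open>(tr A, tr B, tr AB)\<close> with \<open>A, B \<in> SL(2, \<complex>)\<close> and \<open>A\<^sup>m = B\<^sup>n\<close>. The polynomial \<open>D\<close>
  is the trace of the commutator of \<open>A\<close> and \<open>B\<close> minus \<open>2\<close>, and it splits the variety in two parts.

  Where \<open>D \<noteq> 0\<close>, the matrices do not commute. The common power \<open>A\<^sup>m = B\<^sup>n\<close> is by Cayley-Hamilton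
  a linear combination both of \<open>A, I\<close> and of \<open>B, I\<close>; as \<open>A, B, I\<close> satisfy no relation that would
  make \<open>A\<close> and \<open>B\<close> commute, the coefficients of \<open>A\<close> and \<open>B\<close> vanish, so that the power is \<open>I\<close> or \<open>-I\<close>. This restricts \<open>(tr A, tr B)\<close> to finitely
  many pairs and leaves \<open>tr AB\<close> free, which gives vertical lines
  (\<open>central_traces_if_irreducible\<close>, \<open>char_variety_decomposition\<close>). The traces \<open>x\<close> of non-central
  \<open>A\<close> with \<open>A\<^sup>m = \<plusminus>I\<close> are given by \<open>f\<^sub>m(x) = \<plusminus>2\<close>, \<open>x \<noteq> \<plusminus>2\<close>, and these are exactly the roots of the
  generators of \<open>I\<^sub>1\<close> and \<open>I\<^sub>2\<close>
  (\<open>s_poly_root_iff\<close>, \<open>sigma_f_poly_root_iff\<close>).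

  Where \<open>D = 0\<close>, the point equals \<open>(2 cos \<theta>, 2 cos \<phi>, 2 cos (\<theta> + \<phi>))\<close> for complex angles
  \<open>\<theta>, \<phi>\<close>, the character of a pair of diagonal matrices, and \<open>F\<^sub>a\<^sub>,\<^sub>b\<close> takes the value
  \<open>2 cos (a\<theta> - b\<phi>)\<close> there. For diagonal matrices, the relation \<open>A\<^sup>m = B\<^sup>n\<close> and the
  equations of \<open>J\<close> both say that \<open>m\<theta> - n\<phi>\<close> is a multiple of \<open>2\<pi>\<close>. With \<open>m = dp\<close> and \<open>n = dq\<close> this means
  \<open>f\<^sub>d(c) = 2\<close> for \<open>c = 2 cos (p\<theta> - q\<phi>)\<close>, and each such \<open>c\<close> contributes the curve
  \<open>{D = 0, F\<^sub>p\<^sub>,\<^sub>q = c}\<close>. Since \<open>p\<close> and \<open>q\<close> are coprime, a Bezout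
  argument shows that this curve is the image of a single complex line
  \<open>p\<theta> - q\<phi> = const\<close> of angles
  (\<open>reducible_curve_eq_range\<close>).

  Lines and curves are images of entire maps, hence irreducible by the identity theorem
  (\<open>irreducible_range_entire\<close>). None of them contains another, so they are
  the components of their union. It remains to count solutions of \<open>f\<^sub>N(x) = \<plusminus>2\<close>, which are
  the numbers \<open>2 cos (\<pi>k/N)\<close> with \<open>0 \<le> k \<le> N\<close> and \<open>k\<close> of fixed parity
  (\<open>f_poly_solutions\<close>).
\<close>

section \<open>Algebraic sets and their irreducible components\<close>

lemma zero_set_Un: "zero_set (S \<union> T) = zero_set S \<inter> zero_set T"
  by (auto simp: zero_set_def)

lemma algebraic_set_Int:
  assumes "algebraic_set A" "algebraic_set B"
  shows "algebraic_set (A \<inter> B)"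
proof -
  obtain S T where "A = zero_set S" "B = zero_set T"
    using assms unfolding algebraic_set_def by blast
  then have "A \<inter> B = zero_set (S \<union> T)"
    by (simp add: zero_set_Un)
  then show ?thesis
    unfolding algebraic_set_def by blast
qed

lemma algebraic_set_empty: "algebraic_set {}"
  unfolding algebraic_set_def by (rule exI[of _ "{1}"]) (simp add: zero_set_def)

lemma algebraic_set_Un:
  assumes "algebraic_set A" "algebraic_set B"
  shows "algebraic_set (A \<union> B)"
proof -
  obtain S T where ST: "A = zero_set S" "B = zero_set T"
    using assms unfolding algebraic_set_def by blast
  have "A \<union> B = zero_set {p * q | p q. p \<in> S \<and> q \<in> T}"
  proof (intro equalityI subsetI)
    fix v assume "v \<in> A \<union> B"
    then show "v \<in> zero_set {p * q | p q. p \<in> S \<and> q \<in> T}"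
      by (auto simp: ST zero_set_def)
  next
    fix v assume "v \<in> zero_set {p * q | p q. p \<in> S \<and> q \<in> T}"
    then have "eval3 p v * eval3 q v = 0" if "p \<in> S" "q \<in> T" for p q
      using that by (auto simp: zero_set_def simp flip: eval3_simps(11))
    then show "v \<in> A \<union> B"
      by (auto simp: ST zero_set_def)
  qed
  then show ?thesis
    unfolding algebraic_set_def by blast
qed

lemma algebraic_set_Union:
  assumes "finite \<F>" "\<And>F. F \<in> \<F> \<Longrightarrow> algebraic_set F"
  shows "algebraic_set (\<Union>\<F>)"
  using assms
proof (induction \<F> rule: finite_induct)
  case empty
  then show ?case by (simp add: algebraic_set_empty)
next
  case (insert F \<F>)
  then show ?case by (simp add: algebraic_set_Un)
qed

text \<open>Intersecting \<open>C\<close> with one member and with the union of the others writes it as a union of two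
  algebraic sets; irreducibility picks one of them, and induction on the number of members finishes.\<close>

lemma irreducible_subset_Union:
  assumes "finite \<F>" "\<And>F. F \<in> \<F> \<Longrightarrow> algebraic_set F"
    and "irreducible_set C" "C \<subseteq> \<Union>\<F>"
  shows "\<exists>F\<in>\<F>. C \<subseteq> F"
  using assms
proof (induction \<F> rule: finite_induct)
  case empty
  then show ?case by (auto simp: irreducible_set_def)
next
  case (insert F \<F>)
  have C: "algebraic_set C"
    using insert.prems by (simp add: irreducible_set_def)
  have "algebraic_set (C \<inter> F)" "algebraic_set (C \<inter> \<Union>\<F>)"
    using C insert by (auto intro!: algebraic_set_Int algebraic_set_Union)
  moreover have "C = (C \<inter> F) \<union> (C \<inter> \<Union>\<F>)"
    using insert.prems by auto
  ultimately have "C = C \<inter> F \<or> C = C \<inter> \<Union>\<F>"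
    using insert.prems(2) unfolding irreducible_set_def by metis
  then show ?case
  proof
    assume "C = C \<inter> F"
    then have "C \<subseteq> F" by (metis Int_lower2)
    then show ?case by simp
  next
    assume "C = C \<inter> \<Union>\<F>"
    then have "C \<subseteq> \<Union>\<F>" by (metis Int_lower2)
    then have "\<exists>F\<in>\<F>. C \<subseteq> F"
      using insert.IH insert.prems by simp
    then show ?case by simp
  qed
qed

text \<open>This reduces the computation of components to exhibiting a finite cover by irreducible sets
  without inclusions: by \<open>irreducible_subset_Union\<close>, every irreducible subset of the union lies in
  a member, so the maximal ones are the members.\<close>

lemma irreducible_components_Union:
  assumes "finite \<F>" and irr: "\<And>F. F \<in> \<F> \<Longrightarrow> irreducible_set F"
    and anti: "\<And>F G. F \<in> \<F> \<Longrightarrow> G \<in> \<F> \<Longrightarrow> F \<subseteq> G \<Longrightarrow> F = G"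
  shows "irreducible_components (\<Union>\<F>) = \<F>"
proof -
  have cover: "\<exists>F\<in>\<F>. C \<subseteq> F" if "irreducible_set C" "C \<subseteq> \<Union>\<F>" for C
    using irreducible_subset_Union[OF assms(1) _ that] irr irreducible_set_def by blast
  show ?thesis
  proof (intro Set.set_eqI iffI)
    fix C assume "C \<in> irreducible_components (\<Union>\<F>)"
    then have C: "irreducible_set C" "C \<subseteq> \<Union>\<F>"
      and max: "\<And>C'. irreducible_set C' \<Longrightarrow> C \<subseteq> C' \<Longrightarrow> C' \<subseteq> \<Union>\<F> \<Longrightarrow> C' = C"
      by (auto simp: irreducible_components_def)
    obtain F where F: "F \<in> \<F>" "C \<subseteq> F"
      using cover[OF C] by blast
    then have "F = C"
      using max[of F] irr by blast
    with F show "C \<in> \<F>" by simp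
  next
    fix F assume F: "F \<in> \<F>"
    have "C' = F" if C': "irreducible_set C'" "F \<subseteq> C'" "C' \<subseteq> \<Union>\<F>" for C'
    proof -
      obtain G where "G \<in> \<F>" "C' \<subseteq> G"
        using cover C' by blast
      with anti[OF F, of G] C'(2) show ?thesis by blast
    qed
    with F irr show "F \<in> irreducible_components (\<Union>\<F>)"
      unfolding irreducible_components_def by blast
  qed
qed

lemma holomorphic_eval3:
  assumes "f holomorphic_on A" "g holomorphic_on A" "h holomorphic_on A"
  shows "(\<lambda>t. eval3 p (f t, g t, h t)) holomorphic_on A"
proof -
  have X: "(\<lambda>t. poly q (f t)) holomorphic_on A" for q :: "complex poly"
    by (induction q) (auto intro!: holomorphic_intros assms)
  have Y: "(\<lambda>t. poly (poly q [:g t:]) (f t)) holomorphic_on A" for q :: "complex poly poly"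
    by (induction q) (auto intro!: holomorphic_intros assms X)
  have "(\<lambda>t. poly (poly (poly p [:[:h t:]:]) [:g t:]) (f t)) holomorphic_on A"
    by (induction p) (auto intro!: holomorphic_intros assms Y)
  then show ?thesis
    by (simp add: eval3_def)
qed

text \<open>If \<open>W\<close> were a union of two proper algebraic subsets, some polynomials \<open>p\<close> and \<open>q\<close>, one vanishing on
  each subset but not on \<open>W\<close>, would pull back to nonzero entire functions with product zero,
  which the identity theorem excludes. Using entire instead of polynomial parametrizations
  makes trigonometric parametrizations available.\<close>

lemma irreducible_range_entire:
  assumes hol: "f holomorphic_on UNIV" "g holomorphic_on UNIV" "h holomorphic_on UNIV"
    and W: "W = range (\<lambda>t. (f t, g t, h t))" and alg: "algebraic_set W"
  shows "irreducible_set W"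
  unfolding irreducible_set_def
proof (intro conjI allI impI)
  show "W \<noteq> {}" by (simp add: W)
  show "algebraic_set W" by (rule alg)
  fix A B assume AB: "algebraic_set A \<and> algebraic_set B \<and> W = A \<union> B"
  then obtain S T where ST: "A = zero_set S" "B = zero_set T"
    by (auto simp: algebraic_set_def)
  show "W = A \<or> W = B"
  proof (rule ccontr)
    assume "\<not> (W = A \<or> W = B)"
    then obtain a b where "a \<in> W" "a \<notin> A" "b \<in> W" "b \<notin> B"
      using AB by blast
    then obtain r s p q where p: "p \<in> S" "eval3 p (f r, g r, h r) \<noteq> 0"
      and q: "q \<in> T" "eval3 q (f s, g s, h s) \<noteq> 0"
      unfolding W ST zero_set_def by auto
    let ?P = "\<lambda>t. eval3 p (f t, g t, h t)" and ?Q = "\<lambda>t. eval3 q (f t, g t, h t)"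
    have P: "?P holomorphic_on UNIV" and Q: "?Q holomorphic_on UNIV"
      by (rule holomorphic_eval3[OF hol])+
    have PQ: "?P t = 0 \<or> ?Q t = 0" for t
    proof -
      have "(f t, g t, h t) \<in> A \<union> B"
        using AB W by blast
      then show ?thesis
        using p(1) q(1) by (auto simp: ST zero_set_def)
    qed
    have "open (?P -` (- {0}))"
      using holomorphic_on_imp_continuous_on[OF P] by (intro open_vimage) auto
    moreover have "?P -` (- {0}) \<noteq> {}"
      using p(2) by blast
    moreover have "?Q t = 0" if "t \<in> ?P -` (- {0})" for t
      using PQ[of t] that by simp
    ultimately have "?Q s = 0"
      using analytic_continuation_open[of "?P -` (- {0})" UNIV ?Q "\<lambda>_. 0" s] Q
        connected_UNIV by simp
    with q(2) show False by simp
  qed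
qed

lemma zero_set_ideal_gen: "zero_set (ideal_gen S) = zero_set S"
proof
  interpret module "(*) :: poly3 \<Rightarrow> poly3 \<Rightarrow> poly3" by (rule module_mult)
  show "zero_set (ideal_gen S) \<subseteq> zero_set S"
    using span_superset by (auto simp: zero_set_def)
  show "zero_set S \<subseteq> zero_set (ideal_gen S)"
  proof
    fix v assume v: "v \<in> zero_set S"
    have "ideal_gen S \<subseteq> {p. eval3 p v = 0}"
      using v by (intro span_minimal) (auto simp: zero_set_def subspace_def)
    then show "v \<in> zero_set (ideal_gen S)"
      by (auto simp: zero_set_def)
  qed
qed

lemma zero_set_ideal_sum:
  "zero_set {p + q | p q. p \<in> ideal_gen S \<and> q \<in> ideal_gen T} = zero_set S \<inter> zero_set T"
proof -
  interpret module "(*) :: poly3 \<Rightarrow> poly3 \<Rightarrow> poly3" by (rule module_mult)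
  have "ideal_gen S \<union> ideal_gen T \<subseteq> {p + q | p q. p \<in> ideal_gen S \<and> q \<in> ideal_gen T}"
  proof
    fix r assume "r \<in> ideal_gen S \<union> ideal_gen T"
    then have "(r \<in> ideal_gen S \<and> r = r + 0) \<or> (r \<in> ideal_gen T \<and> r = 0 + r)"
      by simp
    with span_zero show "r \<in> {p + q | p q. p \<in> ideal_gen S \<and> q \<in> ideal_gen T}"
      by blast
  qed
  then have "zero_set {p + q | p q. p \<in> ideal_gen S \<and> q \<in> ideal_gen T}
      \<subseteq> zero_set (ideal_gen S) \<inter> zero_set (ideal_gen T)"
    unfolding zero_set_def by blast
  moreover have "zero_set (ideal_gen S) \<inter> zero_set (ideal_gen T)
      \<subseteq> zero_set {p + q | p q. p \<in> ideal_gen S \<and> q \<in> ideal_gen T}"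
    by (auto simp: zero_set_def)
  ultimately show ?thesis
    unfolding zero_set_ideal_gen by (rule equalityI)
qed

section \<open>Representations of a presented group\<close>

text \<open>The homomorphism from the free group that extends \<open>f\<close>, on unreduced words.\<close>

definition word_eval :: "('a, 'b) monoid_scheme \<Rightarrow> ('g \<Rightarrow> 'a) \<Rightarrow> 'g word \<Rightarrow> 'a" where
  "word_eval G f w = foldr (\<lambda>(g, e) a. (if e then f g else inv\<^bsub>G\<^esub> f g) \<otimes>\<^bsub>G\<^esub> a) w \<one>\<^bsub>G\<^esub>"

lemma word_eval_simps [simp]:
  "word_eval G f [] = \<one>\<^bsub>G\<^esub>"
  "word_eval G f ((g, e) # w) = (if e then f g else inv\<^bsub>G\<^esub> f g) \<otimes>\<^bsub>G\<^esub> word_eval G f w"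
  by (simp_all add: word_eval_def)

context group
begin

lemma word_eval_closed:
  assumes "\<And>g. f g \<in> carrier G"
  shows "word_eval G f w \<in> carrier G"
proof (induction w)
  case (Cons l w)
  then show ?case using assms by (cases l) auto
qed simp

lemma word_eval_append:
  assumes "\<And>g. f g \<in> carrier G"
  shows "word_eval G f (u @ v) = word_eval G f u \<otimes> word_eval G f v"
proof (induction u)
  case (Cons l u)
  then show ?case using assms word_eval_closed[of f, OF assms] by (cases l) (auto simp: m_assoc)
qed (simp add: word_eval_closed assms)

lemma word_eval_word_pow:
  assumes "\<And>g. f g \<in> carrier G"
  shows "word_eval G f (word_pow g k) = f g [^] k"
proof -
  have pos: "word_eval G f (replicate n (g, True)) = f g [^] n" for n
  proof (induction n)
    case (Suc n)
    then show ?case using nat_pow_Suc2[OF assms, of g n] by simp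
  qed simp
  have minus: "word_eval G f (replicate n (g, False)) = (inv f g) [^] n" for n
  proof (induction n)
    case (Suc n)
    then show ?case using nat_pow_Suc2[OF inv_closed[OF assms], of g n] by simp
  qed simp
  show ?thesis
  proof (cases k)
    case (nonneg a)
    then show ?thesis
      unfolding nonneg int_pow_int by (simp add: word_pow_def pos)
  next
    case (neg a)
    have "word_pow g k = replicate (Suc a) (g, False)"
      unfolding word_pow_def neg by (simp add: nat_add_distrib)
    then show ?thesis
      unfolding neg int_pow_neg_int[OF assms] nat_pow_inv[OF assms, symmetric]
      by (simp only: minus)
  qed
qed

lemma word_eval_pres_eq:
  assumes f: "\<And>g. f g \<in> carrier G"
    and R: "\<And>u v. (u, v) \<in> R \<Longrightarrow> word_eval G f u = word_eval G f v"
    and "pres_eq R u v"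
  shows "word_eval G f u = word_eval G f v"
  using assms(3)
proof (induction rule: pres_eq.induct)
  case (pres_cancel g e)
  then show ?case using f by simp
qed (simp_all add: word_eval_append f R)

text \<open>Existence part of the universal property: the value of a class is read off from any representative.\<close>

lemma presented_group_hom_exists:
  assumes f: "\<And>g. f g \<in> carrier G"
    and R: "\<And>u v. (u, v) \<in> R \<Longrightarrow> word_eval G f u = word_eval G f v"
  shows "\<exists>\<rho>\<in>hom (presented_group R) G. \<forall>w. \<rho> (pres_class R w) = word_eval G f w"
proof -
  define \<rho> where "\<rho> c = word_eval G f (SOME w. w \<in> c)" for c
  have \<rho>: "\<rho> (pres_class R w) = word_eval G f w" for w
  proof -
    have "w \<in> pres_class R w"
      by (simp add: pres_class_def pres_refl)
    then have "(SOME v. v \<in> pres_class R w) \<in> pres_class R w"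
      by (rule someI)
    then show ?thesis
      unfolding \<rho>_def using word_eval_pres_eq[OF f R] by (auto simp: pres_class_def)
  qed
  have "\<rho> \<in> hom (presented_group R) G"
  proof (rule homI)
    fix a b assume "a \<in> carrier (presented_group R)" "b \<in> carrier (presented_group R)"
    then obtain u v where "a = pres_class R u" "b = pres_class R v"
      by (auto simp: presented_group_def)
    then show "\<rho> a \<in> carrier G" "\<rho> (a \<otimes>\<^bsub>presented_group R\<^esub> b) = \<rho> a \<otimes> \<rho> b"
      by (simp_all add: presented_group_mult \<rho> word_eval_append f word_eval_closed)
  qed
  with \<rho> show ?thesis by blast
qed

text \<open>Uniqueness part of the universal property: a homomorphism is determined by the images of the
  generators, because it sends formal inverses to inverses.\<close>

lemma presented_group_hom_word_eval:
  assumes \<rho>: "\<rho> \<in> hom (presented_group R) G"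
  shows "\<rho> (pres_class R w) = word_eval G (\<lambda>g. \<rho> (pres_class R [(g, True)])) w"
proof -
  have grp: "group_hom (presented_group R) G \<rho>"
    using \<rho> group_presented_group is_group
    by (simp add: group_hom_def group_hom_axioms_def)
  have car: "pres_class R u \<in> carrier (presented_group R)" for u
    by (simp add: presented_group_def)
  have one: "pres_class R [] = \<one>\<^bsub>presented_group R\<^esub>"
    by (simp add: presented_group_def)
  have inv: "\<rho> (pres_class R [(g, False)]) = inv \<rho> (pres_class R [(g, True)])" for g
  proof -
    have "pres_class R [(g, False)] \<otimes>\<^bsub>presented_group R\<^esub> pres_class R [(g, True)]
        = \<one>\<^bsub>presented_group R\<^esub>"
      using pres_cancel[of R g False] by (simp add: presented_group_mult pres_class_eq_iff flip: one)
    then have "inv\<^bsub>presented_group R\<^esub> pres_class R [(g, True)] = pres_class R [(g, False)]"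
      using car by (intro group.inv_equality[OF group_presented_group]) auto
    then show ?thesis
      using group_hom.hom_inv[OF grp car] by metis
  qed
  show ?thesis
  proof (induction w)
    case Nil
    then show ?case using group_hom.hom_one[OF grp] by (simp add: one)
  next
    case (Cons l w)
    obtain g e where l: "l = (g, e)" by fastforce
    have "\<rho> (pres_class R (l # w)) = \<rho> (pres_class R [l]) \<otimes> \<rho> (pres_class R w)"
      using group_hom.hom_mult[OF grp car car, of "[l]" w] by (simp add: presented_group_mult)
    then show ?case
      using Cons.IH inv by (cases e) (auto simp: l)
  qed
qed

end

text \<open>A homomorphism to \<open>SL(2, \<complex>)\<close> amounts to a pair of matrices satisfying the relation.\<close>

lemma char_variety_eq:
  "char_variety m n = {(trace A, trace B, trace (A \<otimes>\<^bsub>SL2\<^esub> B)) | A B.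
     A \<in> carrier SL2 \<and> B \<in> carrier SL2 \<and> A [^]\<^bsub>SL2\<^esub> m = B [^]\<^bsub>SL2\<^esub> n}"
proof -
  interpret SL2: group SL2 by (rule group_SL2)
  let ?R = "G_rel m n"
  have xy: "G_x m n \<otimes>\<^bsub>G_mn m n\<^esub> G_y m n = pres_class ?R [(GenX, True), (GenY, True)]"
    by (simp add: G_x_def G_y_def G_mn_def presented_group_mult)
  show ?thesis
  proof (intro Set.set_eqI iffI)
    fix v assume "v \<in> char_variety m n"
    then obtain \<rho> where \<rho>: "\<rho> \<in> hom (presented_group ?R) SL2"
      and v: "v = (trace (\<rho> (G_x m n)), trace (\<rho> (G_y m n)), trace (\<rho> (G_x m n \<otimes>\<^bsub>G_mn m n\<^esub> G_y m n)))"
      by (auto simp: char_variety_def G_mn_def)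
    let ?f = "\<lambda>g. \<rho> (pres_class ?R [(g, True)])"
    have f: "?f g \<in> carrier SL2" for g
      using \<rho> by (rule hom_in_carrier) (simp add: presented_group_def)
    have "pres_class ?R (word_pow GenX m) = pres_class ?R (word_pow GenY n)"
      by (simp add: pres_class_eq_iff G_rel_def pres_rel)
    then have "?f GenX [^]\<^bsub>SL2\<^esub> m = ?f GenY [^]\<^bsub>SL2\<^esub> n"
      using SL2.presented_group_hom_word_eval[OF \<rho>] SL2.word_eval_word_pow[of ?f, OF f] by metis
    moreover have "v = (trace (?f GenX), trace (?f GenY), trace (?f GenX \<otimes>\<^bsub>SL2\<^esub> ?f GenY))"
      unfolding v xy SL2.presented_group_hom_word_eval[OF \<rho>, of "[_, _]"]
      using f by (simp add: G_x_def G_y_def)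
    ultimately show "v \<in> {(trace A, trace B, trace (A \<otimes>\<^bsub>SL2\<^esub> B)) | A B.
        A \<in> carrier SL2 \<and> B \<in> carrier SL2 \<and> A [^]\<^bsub>SL2\<^esub> m = B [^]\<^bsub>SL2\<^esub> n}"
      using f by blast
  next
    fix v assume "v \<in> {(trace A, trace B, trace (A \<otimes>\<^bsub>SL2\<^esub> B)) | A B.
        A \<in> carrier SL2 \<and> B \<in> carrier SL2 \<and> A [^]\<^bsub>SL2\<^esub> m = B [^]\<^bsub>SL2\<^esub> n}"
    then obtain A B where AB: "A \<in> carrier SL2" "B \<in> carrier SL2"
      and eq: "A [^]\<^bsub>SL2\<^esub> m = B [^]\<^bsub>SL2\<^esub> n"
      and v: "v = (trace A, trace B, trace (A \<otimes>\<^bsub>SL2\<^esub> B))" by blast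
    let ?f = "case_gens A B"
    have f: "?f g \<in> carrier SL2" for g
      using AB by (cases g) auto
    have R: "word_eval SL2 ?f u = word_eval SL2 ?f v" if "(u, v) \<in> ?R" for u v
      using that eq SL2.word_eval_word_pow[of ?f, OF f] by (simp add: G_rel_def)
    obtain \<rho> where "\<rho> \<in> hom (presented_group ?R) SL2"
      and \<rho>: "\<And>w. \<rho> (pres_class ?R w) = word_eval SL2 ?f w"
      using SL2.presented_group_hom_exists[of ?f ?R, OF f R] by blast
    moreover have "v = (trace (\<rho> (G_x m n)), trace (\<rho> (G_y m n)), trace (\<rho> (G_x m n \<otimes>\<^bsub>G_mn m n\<^esub> G_y m n)))"
      unfolding v xy \<rho> using AB by (simp add: G_x_def G_y_def \<rho>)
    ultimately show "v \<in> char_variety m n"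
      unfolding char_variety_def G_mn_def by blast
  qed
qed

section \<open>Roots of the recursive polynomials\<close>

text \<open>Two interleaved two-step inductions, over the even and over the odd integers; it matches the
  recursions of \<open>s\<^sub>k\<close> and \<open>\<sigma>\<^sub>k\<close>.\<close>

lemma int_four_step_induct:
  fixes P :: "int \<Rightarrow> bool"
  assumes base: "P 0" "P 1" "P 2" "P 3"
    and up: "\<And>k. P (k - 2) \<Longrightarrow> P (k - 4) \<Longrightarrow> P k"
    and down: "\<And>k. P (k + 2) \<Longrightarrow> P (k + 4) \<Longrightarrow> P k"
  shows "P k"
proof -
  have "P (2 * j) \<and> P (2 * j + 1)" for j
  proof (induction j rule: int_two_step_induct)
    case (3 j)
    then show ?case using up[of "2 * j"] up[of "2 * j + 1"] by (simp add: algebra_simps)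
  next
    case (4 j)
    then show ?case using down[of "2 * j"] down[of "2 * j + 1"] by (simp add: algebra_simps)
  qed (use base in simp_all)
  from this[of "k div 2"] show ?thesis
    by (cases "even k") (auto elim: oddE)
qed

lemma f_poly_eval_rec:
  "poly (f_poly k) x = x * poly (f_poly (k - 1)) x - poly (f_poly (k - 2)) x"
  "poly (f_poly k) x = x * poly (f_poly (k + 1)) x - poly (f_poly (k + 2)) x"
  using arg_cong[OF f_poly_rec[of k], of "\<lambda>p. poly p x"]
    arg_cong[OF f_poly_rec[of "k + 2"], of "\<lambda>p. poly p x"] by (simp_all add: algebra_simps)

lemma s_poly_eval_rec:
  "poly (s_poly k) x = x * poly (s_poly (k - 2)) x - poly (s_poly (k - 4)) x"
  "poly (s_poly k) x = x * poly (s_poly (k + 2)) x - poly (s_poly (k + 4)) x"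
  using arg_cong[OF s_poly_rec[of k], of "\<lambda>p. poly p x"]
    arg_cong[OF s_poly_rec[of "k + 4"], of "\<lambda>p. poly p x"] by (simp_all add: algebra_simps)

lemma sigma_poly_eval_rec:
  "poly (sigma_poly k) x = x * poly (sigma_poly (k - 2)) x - poly (sigma_poly (k - 4)) x"
  "poly (sigma_poly k) x = x * poly (sigma_poly (k + 2)) x - poly (sigma_poly (k + 4)) x"
  using arg_cong[OF sigma_poly_rec[of k], of "\<lambda>p. poly p x"]
    arg_cong[OF sigma_poly_rec[of "k + 4"], of "\<lambda>p. poly p x"] by (simp_all add: algebra_simps)

lemma two_cos_surj: "\<exists>\<theta>::complex. x = 2 * cos \<theta>"
  by (rule exI[of _ "Arccos (x / 2)"]) simp

lemma cos_chebyshev: "cos b * cos a * 2 - cos (b - a) = cos (b + a)" for a b :: complex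
  by (simp add: cos_add cos_diff)

lemma sin_chebyshev: "sin b * cos a * 2 - sin (b - a) = sin (b + a)" for a b :: complex
  by (simp add: sin_add sin_diff)

text \<open>The \<open>f\<^sub>k\<close> are Chebyshev polynomials. As the complex cosine is surjective, this
  determines them, and most facts about \<open>f\<^sub>k\<close> below are read off from it.\<close>

lemma f_poly_two_cos: "poly (f_poly k) (2 * cos \<theta>) = 2 * cos (of_int k * \<theta>)"
proof (induction k rule: int_two_step_induct)
  case (3 k)
  have "2 * cos \<theta> * (2 * cos (of_int (k - 1) * \<theta>)) - 2 * cos (of_int (k - 2) * \<theta>) = 2 * cos (of_int k * \<theta>)"
    using cos_chebyshev[of "of_int (k - 1) * \<theta>" \<theta>] by (simp add: algebra_simps)
  then show ?case
    unfolding f_poly_eval_rec(1)[of k] 3 .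
next
  case (4 k)
  have "2 * cos \<theta> * (2 * cos (of_int (k + 1) * \<theta>)) - 2 * cos (of_int (k + 2) * \<theta>) = 2 * cos (of_int k * \<theta>)"
    using cos_chebyshev[of "of_int (k + 1) * \<theta>" "- \<theta>"] by (simp add: algebra_simps)
  then show ?case
    unfolding f_poly_eval_rec(2)[of k] 4 .
qed (simp_all add: f_poly_base)

text \<open>A quotient of sines of multiples of the half angle. Writing it as a product keeps the identity, and
  its inductive proof, valid where the denominator vanishes.\<close>

lemma s_poly_two_cos:
  "poly (s_poly k) (2 * cos (2 * h)) * (if even k then sin (2 * h) else sin h) = sin (of_int k * h)"
proof -
  define c where "c k = (if even k then sin (2 * h) else sin h)" for k :: int
  have c: "c (k - 2) = c k" "c (k - 4) = c k" "c (k + 2) = c k" "c (k + 4) = c k" for k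
    by (simp_all add: c_def)
  have "poly (s_poly k) (2 * cos (2 * h)) * c k = sin (of_int k * h)"
  proof (induction k rule: int_four_step_induct)
    case 4
    have "(2 * cos (2 * h) + 1) * sin h = sin (3 * h)"
      using sin_chebyshev[of h "2 * h"] by (simp add: algebra_simps)
    then show ?case by (simp add: s_poly_base c_def add.commute)
  next
    case (5 k)
    have "2 * cos (2 * h) * sin (of_int (k - 2) * h) - sin (of_int (k - 4) * h) = sin (of_int k * h)"
      using sin_chebyshev[of "of_int (k - 2) * h" "2 * h"] by (simp add: algebra_simps)
    then show ?case
      using 5 unfolding s_poly_eval_rec(1)[of k] c by (simp add: left_diff_distrib mult.assoc)
  next
    case (6 k)
    have "2 * cos (2 * h) * sin (of_int (k + 2) * h) - sin (of_int (k + 4) * h) = sin (of_int k * h)"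
      using sin_chebyshev[of "of_int (k + 2) * h" "- (2 * h)"] by (simp add: algebra_simps)
    then show ?case
      using 6 unfolding s_poly_eval_rec(2)[of k] c by (simp add: left_diff_distrib mult.assoc)
  qed (simp_all add: s_poly_base c_def)
  then show ?thesis by (simp add: c_def)
qed

text \<open>At \<open>2\<close> and \<open>- 2\<close> the trigonometric formula degenerates, so the values come from the recursion.\<close>

lemma s_poly_at_2: "poly (s_poly k) 2 = (if even k then of_int k / 2 else of_int k)"
proof (induction k rule: int_four_step_induct)
  case (5 k)
  then show ?case unfolding s_poly_eval_rec(1)[of k] by (simp add: field_simps)
next
  case (6 k)
  then show ?case unfolding s_poly_eval_rec(2)[of k] by (simp add: field_simps)
qed (simp_all add: s_poly_base)

lemma s_poly_at_minus_2:
  "poly (s_poly (2 * j)) (- 2) = (if even j then - of_int j else of_int j)"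
  "poly (s_poly (2 * j + 1)) (- 2) = (if even j then 1 else - 1)"
proof -
  have "poly (s_poly (2 * j)) (- 2) = (if even j then - of_int j else of_int j) \<and>
    poly (s_poly (2 * j + 1)) (- 2) = (if even j then 1 else - 1)"
  proof (induction j rule: int_two_step_induct)
    case (3 k)
    have i: "2 * k - 2 = 2 * (k - 1)" "2 * k - 4 = 2 * (k - 2)"
      "2 * k + 1 - 2 = 2 * (k - 1) + 1" "2 * k + 1 - 4 = 2 * (k - 2) + 1" by simp_all
    show ?case
      unfolding s_poly_eval_rec(1)[of "2 * k"] s_poly_eval_rec(1)[of "2 * k + 1"] i
        3[THEN conjunct1] 3[THEN conjunct2] by simp
  next
    case (4 k)
    have i: "2 * k + 2 = 2 * (k + 1)" "2 * k + 4 = 2 * (k + 2)"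
      "2 * k + 1 + 2 = 2 * (k + 1) + 1" "2 * k + 1 + 4 = 2 * (k + 2) + 1" by simp_all
    show ?case
      unfolding s_poly_eval_rec(2)[of "2 * k"] s_poly_eval_rec(2)[of "2 * k + 1"] i
        4[THEN conjunct1] 4[THEN conjunct2] by simp
  qed (simp_all add: s_poly_base)
  then show "poly (s_poly (2 * j)) (- 2) = (if even j then - of_int j else of_int j)"
    "poly (s_poly (2 * j + 1)) (- 2) = (if even j then 1 else - 1)" by blast+
qed

lemma sin_eq_0_iff_two_cos: "sin \<theta> = 0 \<longleftrightarrow> 2 * cos \<theta> = 2 \<or> 2 * cos \<theta> = - 2" for \<theta> :: complex
proof -
  have "(sin \<theta>)\<^sup>2 = (1 - cos \<theta>) * (1 + cos \<theta>)"
    by (simp add: sin_squared_eq algebra_simps power2_eq_square)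
  then have "sin \<theta> = 0 \<longleftrightarrow> 1 - cos \<theta> = 0 \<or> 1 + cos \<theta> = 0"
    by (metis mult_eq_0_iff power2_eq_square)
  also have "\<dots> \<longleftrightarrow> 2 * cos \<theta> = 2 \<or> 2 * cos \<theta> = - 2"
    by (auto simp: add_eq_0_iff)
  finally show ?thesis .
qed

text \<open>With \<open>x = 2 cos 2h\<close>, the polynomial \<open>s\<^sub>m\<close> vanishes iff \<open>sin mh = 0\<close>, that is \<open>cos 2mh = 1\<close>, which is
  \<open>f\<^sub>m(x) = 2\<close>. The points \<open>\<plusminus>2\<close>, where the factor \<open>sin 2h\<close> vanishes, are never roots.\<close>

lemma s_poly_root_iff:
  assumes "m \<noteq> 0"
  shows "poly (s_poly m) x = 0 \<longleftrightarrow> poly (f_poly m) x = 2 \<and> x \<noteq> 2 \<and> x \<noteq> - 2"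
proof (cases "x = 2 \<or> x = - 2")
  case True
  have "poly (s_poly m) x \<noteq> 0"
  proof (cases "x = 2")
    case False
    with True have "x = - 2" by simp
    then show ?thesis
      using assms s_poly_at_minus_2[of "m div 2"] by (cases "even m") (auto elim!: evenE oddE)
  qed (use assms s_poly_at_2 in simp)
  with True show ?thesis by auto
next
  case False
  obtain \<theta> where "x = 2 * cos \<theta>" using two_cos_surj by blast
  then have "x = 2 * cos (2 * (\<theta> / 2))" by simp
  then obtain h where x: "x = 2 * cos (2 * h)" by blast
  have s2: "sin (2 * h) \<noteq> 0"
    using False sin_eq_0_iff_two_cos x by blast
  then have "sin h \<noteq> 0"
    by (auto simp: sin_double)
  with s2 have "poly (s_poly m) x = 0 \<longleftrightarrow> sin (of_int m * h) = 0"
    using s_poly_two_cos[of m h] x by (auto split: if_splits)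
  also have "\<dots> \<longleftrightarrow> cos (2 * (of_int m * h)) = 1"
    by (simp add: cos_double_sin)
  also have "\<dots> \<longleftrightarrow> poly (f_poly m) x = 2"
    unfolding x f_poly_two_cos by (simp add: mult.left_commute)
  finally show ?thesis using False by simp
qed

lemma f_poly_minus: "poly (f_poly k) (- x) = (if even k then 1 else - 1) * poly (f_poly k) x"
proof (induction k rule: int_two_step_induct)
  case (3 k)
  then show ?case unfolding f_poly_eval_rec(1)[of k] by (simp add: algebra_simps)
next
  case (4 k)
  then show ?case unfolding f_poly_eval_rec(2)[of k] by (simp add: algebra_simps)
qed (simp_all add: f_poly_base)

text \<open>The substitution \<open>x \<mapsto> - x\<close> shifts the angle by \<open>\<pi>\<close> and so exchanges the two families of odd index; it
  transfers \<open>s_poly_root_iff\<close> to \<open>\<sigma>\<^sub>m\<close>.\<close>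

lemma sigma_poly_odd_eq_s_poly:
  "poly (sigma_poly (2 * j + 1)) x = (if even j then 1 else - 1) * poly (s_poly (2 * j + 1)) (- x)"
proof (induction j rule: int_two_step_induct)
  case (3 k)
  have i: "2 * k + 1 - 2 = 2 * (k - 1) + 1" "2 * k + 1 - 4 = 2 * (k - 2) + 1" by simp_all
  show ?case
    unfolding s_poly_eval_rec(1)[of "2 * k + 1"] sigma_poly_eval_rec(1)[of "2 * k + 1"] i 3
    by simp
next
  case (4 k)
  have i: "2 * k + 1 + 2 = 2 * (k + 1) + 1" "2 * k + 1 + 4 = 2 * (k + 2) + 1" by simp_all
  show ?case
    unfolding s_poly_eval_rec(2)[of "2 * k + 1"] sigma_poly_eval_rec(2)[of "2 * k + 1"] i 4
    by simp
qed (simp_all add: s_poly_base sigma_poly_base)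

text \<open>The generators of \<open>I\<^sub>2\<close> detect \<open>A\<^sup>m = - I\<close> in the way those of \<open>I\<^sub>1\<close> detect \<open>A\<^sup>m = I\<close>. For odd \<open>m\<close> this
  is the previous case at \<open>- x\<close>. For even \<open>m = 2j\<close> it is \<open>f\<^sub>m = f\<^sub>j\<^sup>2 - 2\<close>; then
  \<open>f\<^sub>m(\<plusminus>2) = 2\<close> excludes \<open>\<plusminus>2\<close> automatically.\<close>

lemma sigma_f_poly_root_iff:
  assumes "m \<noteq> 0"
  shows "poly (if odd m then sigma_poly m else f_poly (m div 2)) x = 0 \<longleftrightarrow>
    poly (f_poly m) x = - 2 \<and> x \<noteq> 2 \<and> x \<noteq> - 2"
proof (cases "odd m")
  case True
  then obtain j where j: "m = 2 * j + 1" by (elim oddE)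
  have "poly (sigma_poly m) x = 0 \<longleftrightarrow> poly (s_poly m) (- x) = 0"
    unfolding j sigma_poly_odd_eq_s_poly by simp
  moreover have neg: "- y = c \<longleftrightarrow> y = - c" for y c :: complex
    by (metis minus_minus)
  ultimately show ?thesis
    using True s_poly_root_iff[OF assms, of "- x"] unfolding f_poly_minus
    by (simp add: neg conj_commute)
next
  case False
  then obtain j where j: "m = 2 * j" by (auto elim: evenE)
  obtain \<theta> where x: "x = 2 * cos \<theta>" using two_cos_surj by blast
  have f: "poly (f_poly m) x = 2 * cos (2 * (of_int j * \<theta>))"
    unfolding x f_poly_two_cos j by (simp add: mult.assoc)
  have "poly (f_poly j) x = 0 \<longleftrightarrow> cos (of_int j * \<theta>) = 0"
    unfolding x f_poly_two_cos by simp
  also have "\<dots> \<longleftrightarrow> poly (f_poly m) x = - 2"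
    unfolding f cos_double_cos by simp
  finally have *: "poly (f_poly j) x = 0 \<longleftrightarrow> poly (f_poly m) x = - 2" .
  have "poly (f_poly m) 2 = 2" "poly (f_poly m) (- 2) = 2"
    using f_poly_two_cos[of m 0] False by (simp_all add: f_poly_minus)
  with * False j show ?thesis by auto
qed

text \<open>Reduce \<open>r\<close> modulo \<open>2N\<close> and reflect \<open>r \<mapsto> 2N - r\<close> if the remainder exceeds \<open>N\<close>; both moves
  preserve parity.\<close>

lemma cos_reduce_mod:
  assumes "0 < N"
  shows "\<exists>k\<in>{0..N}. cos (pi * of_int k / of_int N) = cos (pi * of_int r / of_int N) \<and> (even k \<longleftrightarrow> even r)"
proof -
  define r' where "r' = r mod (2 * N)"
  have r': "0 \<le> r'" "r' < 2 * N" and r: "r = r' + 2 * N * (r div (2 * N))"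
    using assms by (simp_all add: r'_def)
  have even: "even r' \<longleftrightarrow> even r"
    by (metis even_add even_mult_iff even_numeral r)
  have "pi * of_int r / of_int N = pi * of_int r' / of_int N + 2 * pi * of_int (r div (2 * N))"
    using assms by (subst r) (simp add: field_simps)
  then have "cos (pi * of_int r / of_int N) = cos (pi * of_int r' / of_int N)"
    by (simp add: cos_add)
  moreover have "cos (pi * of_int (2 * N - r') / of_int N) = cos (pi * of_int r' / of_int N)"
  proof -
    have "pi * of_int (2 * N - r') / of_int N = - (pi * of_int r' / of_int N) + 2 * pi"
      using assms by (simp add: field_simps)
    then show ?thesis by (simp only: cos_periodic cos_minus)
  qed
  moreover have "r' \<in> {0..N} \<or> 2 * N - r' \<in> {0..N}" "even (2 * N - r') \<longleftrightarrow> even r"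
    using r' even by auto
  ultimately show ?thesis
    using even by metis
qed

text \<open>If \<open>x = 2 cos \<theta>\<close> with \<open>cos N\<theta> = \<plusminus>1\<close>, then \<open>sin N\<theta> = 0\<close> forces \<open>\<theta>\<close> to be a real multiple \<open>\<pi>r/N\<close>, and
  the sign is the parity of \<open>r\<close>.\<close>

lemma f_poly_solutions:
  assumes "0 < N"
  shows "{x. poly (f_poly N) x = (if E then 2 else - 2)} =
    (\<lambda>k. complex_of_real (2 * cos (pi * of_int k / of_int N))) ` {k\<in>{0..N}. even k \<longleftrightarrow> E}"
    (is "?L = ?f ` ?K")
proof (intro equalityI subsetI)
  fix x assume x: "x \<in> ?L"
  obtain \<theta> where \<theta>: "x = 2 * cos \<theta>" using two_cos_surj by blast
  then have c: "cos (of_int N * \<theta>) = (if E then 1 else - 1)"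
    using x by (auto simp: f_poly_two_cos split: if_splits)
  then have "sin (of_int N * \<theta>) = 0"
    unfolding sin_eq_0_iff_two_cos by auto
  then obtain r where r: "of_int N * \<theta> = of_real (of_int r * pi)"
    unfolding sin_eq_0 by auto
  have "cos (of_int N * \<theta>) = of_real (cos (pi * of_int r))"
    unfolding r cos_of_real by (simp add: mult.commute)
  with c have E: "even r \<longleftrightarrow> E"
    by (auto simp: cos_npi_int split: if_splits)
  have "\<theta> = of_real (pi * of_int r / of_int N)"
    using r assms by (simp add: field_simps)
  then have "x = 2 * of_real (cos (pi * of_int r / of_int N))"
    by (simp only: \<theta> cos_of_real)
  then have "x = ?f r" by simp
  moreover obtain k where "k \<in> {0..N}" "cos (pi * of_int k / of_int N) = cos (pi * of_int r / of_int N)"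
    "even k \<longleftrightarrow> even r"
    using cos_reduce_mod[OF assms] by blast
  ultimately show "x \<in> ?f ` ?K"
    using E by (intro image_eqI[of _ _ k]) auto
next
  fix x assume "x \<in> ?f ` ?K"
  then obtain k where k: "even k \<longleftrightarrow> E" "x = ?f k" by auto
  have "x = 2 * cos (of_real (pi * of_int k / of_int N))"
    unfolding k(2) cos_of_real by simp
  then have "poly (f_poly N) x = 2 * cos (of_int N * of_real (pi * of_int k / of_int N))"
    by (simp only: f_poly_two_cos)
  also have "of_int N * of_real (pi * of_int k / of_int N) = (of_real (pi * of_int k) :: complex)"
    using assms by simp
  also have "2 * cos (of_real (pi * of_int k)) = (2 * of_real (if even k then 1 else - 1) :: complex)"
    by (simp only: cos_of_real cos_npi_int)
  finally show "x \<in> ?L" using k by auto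
qed

lemma inj_on_cos_multiples:
  assumes "0 < N"
  shows "inj_on (\<lambda>k. complex_of_real (2 * cos (pi * of_int k / of_int N))) {0..N}"
proof (rule inj_onI)
  have range: "0 \<le> pi * of_int k / of_int N" "pi * of_int k / of_int N \<le> pi" if "k \<in> {0..N}" for k
  proof -
    have "0 \<le> real_of_int k / of_int N" "real_of_int k / of_int N \<le> 1"
      using that assms by simp_all
    then show "0 \<le> pi * of_int k / of_int N" "pi * of_int k / of_int N \<le> pi"
      using mult_left_le[of "of_int k / of_int N" pi] mult_nonneg_nonneg[OF pi_ge_zero, of "of_int k / of_int N"]
      by simp_all
  qed
  fix k l assume kl: "k \<in> {0..N}" "l \<in> {0..N}"
    and "complex_of_real (2 * cos (pi * of_int k / of_int N)) = complex_of_real (2 * cos (pi * of_int l / of_int N))"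
  then have "cos (pi * of_int k / of_int N) = cos (pi * of_int l / of_int N)"
    by (simp only: of_real_eq_iff)
  then have "pi * of_int k / of_int N = pi * of_int l / of_int N"
    using range[OF kl(1)] range[OF kl(2)] by (blast intro: cos_inj_pi)
  then have "real_of_int k / of_int N = of_int l / of_int N"
    by (metis mult_left_cancel pi_neq_zero times_divide_eq_right)
  then show "k = l" using assms by simp
qed

lemma card_f_poly_solutions:
  assumes "0 < d"
  shows "finite {x. poly (f_poly d) x = 2}" "int (card {x. poly (f_poly d) x = 2}) = d div 2 + 1"
proof -
  have sol: "{x. poly (f_poly d) x = 2} =
    (\<lambda>k. complex_of_real (2 * cos (pi * of_int k / of_int d))) ` {k\<in>{0..d}. even k}"
    using f_poly_solutions[OF assms, of True] by simp
  show "finite {x. poly (f_poly d) x = 2}"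
    unfolding sol by (rule finite_imageI, rule finite_subset[of _ "{0..d}"]) auto
  have "{k\<in>{0..d}. even k} = (\<lambda>j. 2 * j) ` {0..d div 2}"
  proof (intro equalityI subsetI)
    fix k assume k: "k \<in> {k\<in>{0..d}. even k}"
    then obtain j where "k = 2 * j" by blast
    then show "k \<in> (\<lambda>j. 2 * j) ` {0..d div 2}"
      using k by (intro image_eqI[of _ _ j]) auto
  qed auto
  then have "int (card {k\<in>{0..d}. even k}) = d div 2 + 1"
    using assms by (simp add: card_image inj_on_def)
  then show "int (card {x. poly (f_poly d) x = 2}) = d div 2 + 1"
    unfolding sol
    by (subst card_image) (rule inj_on_subset[OF inj_on_cos_multiples[OF assms]], auto)
qed

text \<open>The possible traces of non-central matrices in \<open>SL(2, \<complex>)\<close> whose \<open>m\<close>-th power is \<open>I\<close>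
  (if \<open>E\<close> holds) or \<open>- I\<close> (otherwise).\<close>

definition central_traces :: "bool \<Rightarrow> int \<Rightarrow> complex set" where
  "central_traces E m = {x. poly (f_poly m) x = (if E then 2 else - 2) \<and> x \<noteq> 2 \<and> x \<noteq> - 2}"

lemma f_poly_uminus: "poly (f_poly (- m)) x = poly (f_poly m) x"
  using two_cos_surj[of x] by (auto simp: f_poly_two_cos)

lemma central_traces_abs: "central_traces E \<bar>m\<bar> = central_traces E m"
  by (simp add: central_traces_def abs_if f_poly_uminus)

text \<open>Among the \<open>2 cos (\<pi>k/N)\<close> with \<open>0 \<le> k \<le> N\<close>, the excluded values \<open>2\<close> and \<open>- 2\<close> are those at the endpoints
  \<open>k = 0\<close> and \<open>k = N\<close>. So one counts the even, respectively odd, integers strictly between \<open>0\<close> and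
  \<open>N\<close>.\<close>

lemma card_central_traces:
  assumes "m \<noteq> 0"
  shows "finite (central_traces E m)"
    "int (card (central_traces E m)) = (if E then (\<bar>m\<bar> - 1) div 2 else \<bar>m\<bar> div 2)"
proof -
  define N where "N = \<bar>m\<bar>"
  have N: "0 < N" using assms by (simp add: N_def)
  let ?f = "\<lambda>k. complex_of_real (2 * cos (pi * of_int k / of_int N))"
  have inj: "inj_on ?f {0..N}" by (rule inj_on_cos_multiples[OF N])
  have ends: "?f 0 = 2" "?f N = - 2" using N by simp_all
  have ne: "?f k \<noteq> 2 \<and> ?f k \<noteq> - 2 \<longleftrightarrow> k \<noteq> 0 \<and> k \<noteq> N" if "k \<in> {0..N}" for k
    using inj_onD[OF inj, of k 0] inj_onD[OF inj, of k N] that ends N by auto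
  have "central_traces E N = {x \<in> ?f ` {k\<in>{0..N}. even k \<longleftrightarrow> E}. x \<noteq> 2 \<and> x \<noteq> - 2}"
    unfolding central_traces_def f_poly_solutions[OF N, symmetric] by auto
  also have "\<dots> = ?f ` {k\<in>{0<..<N}. even k \<longleftrightarrow> E}"
  proof -
    have "k \<in> {0<..<N} \<longleftrightarrow> k \<in> {0..N} \<and> ?f k \<noteq> 2 \<and> ?f k \<noteq> - 2" for k
    proof (cases "k \<in> {0..N}")
      case True
      then show ?thesis unfolding ne[OF True] by auto
    qed auto
    then have "{k\<in>{0<..<N}. even k \<longleftrightarrow> E} = {k\<in>{k\<in>{0..N}. even k \<longleftrightarrow> E}. ?f k \<noteq> 2 \<and> ?f k \<noteq> - 2}"
      by blast
    moreover have "{x \<in> f ` A. P x} = f ` {k\<in>A. P (f k)}" for f :: "int \<Rightarrow> complex" and A P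
      by blast
    ultimately show ?thesis by (simp only:)
  qed
  finally have eq: "central_traces E m = ?f ` {k\<in>{0<..<N}. even k \<longleftrightarrow> E}"
    unfolding N_def central_traces_abs .
  show "finite (central_traces E m)"
    unfolding eq by (rule finite_imageI, rule finite_subset[of _ "{0..N}"]) auto
  have "{k\<in>{0<..<N}. even k} = (\<lambda>j. 2 * j) ` {0<..(N - 1) div 2}"
  proof (intro equalityI subsetI)
    fix k assume k: "k \<in> {k\<in>{0<..<N}. even k}"
    then obtain j where "k = 2 * j" by blast
    then show "k \<in> (\<lambda>j. 2 * j) ` {0<..(N - 1) div 2}"
      using k by (intro image_eqI[of _ _ j]) auto
  qed auto
  then have e: "int (card {k\<in>{0<..<N}. even k}) = (N - 1) div 2"
    using N by (simp add: card_image inj_on_def)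
  have "{k\<in>{0<..<N}. odd k} = (\<lambda>j. 2 * j - 1) ` {0<..N div 2}"
  proof (intro equalityI subsetI)
    fix k assume k: "k \<in> {k\<in>{0<..<N}. odd k}"
    then obtain j where "k = 2 * j + 1" by (auto elim: oddE)
    then show "k \<in> (\<lambda>j. 2 * j - 1) ` {0<..N div 2}"
      using k by (intro image_eqI[of _ _ "j + 1"]) auto
  qed auto
  then have o: "int (card {k\<in>{0<..<N}. odd k}) = N div 2"
    using N by (simp add: card_image inj_on_def)
  have "card (central_traces E m) = card {k\<in>{0<..<N}. even k \<longleftrightarrow> E}"
    unfolding eq by (rule card_image, rule inj_on_subset[OF inj]) auto
  then show "int (card (central_traces E m)) = (if E then (\<bar>m\<bar> - 1) div 2 else \<bar>m\<bar> div 2)"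
    using e o by (cases E) (auto simp: N_def)
qed

section \<open>The surface of reducible characters\<close>

text \<open>The character of the pair of diagonal matrices with eigenvalues \<open>exp (\<plusminus>\<i>\<theta>)\<close> and \<open>exp (\<plusminus>\<i>\<phi>)\<close>.\<close>

definition trig_point :: "complex \<Rightarrow> complex \<Rightarrow> point3" where
  "trig_point \<theta> \<phi> = (2 * cos \<theta>, 2 * cos \<phi>, 2 * cos (\<theta> + \<phi>))"

lemma trig_point_minus: "trig_point (- \<theta>) (- \<phi>) = trig_point \<theta> \<phi>"
  using cos_minus[of "\<theta> + \<phi>"] by (simp add: trig_point_def)

lemma cos_plus_2pi_int: "cos (\<theta> + 2 * of_real pi * of_int j) = cos \<theta>" for \<theta> :: complex
proof -
  have "cos (\<theta> + of_real (2 * of_int j * pi)) = cos \<theta>"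
    by (subst complex_cos_eq) (rule bexI[of _ "of_int j"], simp_all)
  then show ?thesis by (simp add: mult_ac)
qed

lemma trig_point_plus_2pi_int:
  "trig_point (\<theta> + 2 * of_real pi * of_int i) (\<phi> + 2 * of_real pi * of_int j) = trig_point \<theta> \<phi>"
proof -
  have "\<theta> + 2 * of_real pi * of_int i + (\<phi> + 2 * of_real pi * of_int j) = \<theta> + \<phi> + 2 * of_real pi * of_int (i + j)"
    by (simp add: algebra_simps)
  then show ?thesis
    unfolding trig_point_def by (simp only: cos_plus_2pi_int)
qed

lemma cos_eq_cos_cases:
  fixes a b :: complex
  assumes "cos a = cos b"
  obtains j where "a = b + 2 * of_real pi * of_int j" | j where "a = - b + 2 * of_real pi * of_int j"
proof -
  obtain r :: real where "r \<in> \<int>" and r: "a = b + of_real (2 * r * pi) \<or> a = - b + of_real (2 * r * pi)"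
    using assms unfolding complex_cos_eq by blast
  then obtain j where "r = of_int j" by (auto elim: Ints_cases)
  then show thesis
    using r that[of j] by (auto simp: mult_ac)
qed

lemma eval3_D_poly:
  "eval3 D_poly (x, y, z) = x\<^sup>2 + y\<^sup>2 + z\<^sup>2 - x * y * z - 4"
  by (simp add: D_poly_def)

text \<open>For \<open>x = 2 cos \<theta>\<close> and \<open>y = 2 cos \<phi>\<close>, the polynomial \<open>D\<close> is quadratic in \<open>z\<close> with roots
  \<open>2 cos (\<theta> + \<phi>)\<close> and \<open>2 cos (\<theta> - \<phi>)\<close>. The second root arises from the first by
  \<open>\<phi> \<mapsto> - \<phi>\<close>, which fixes \<open>y\<close>.\<close>

lemma D_poly_zero_iff: "eval3 D_poly v = 0 \<longleftrightarrow> (\<exists>\<theta> \<phi>. v = trig_point \<theta> \<phi>)"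
proof -
  have D: "eval3 D_poly (2 * cos \<theta>, 2 * cos \<phi>, z) = (z - 2 * cos (\<theta> + \<phi>)) * (z - 2 * cos (\<theta> - \<phi>))"
    for \<theta> \<phi> z :: complex
  proof -
    have "(sin \<theta>)\<^sup>2 = 1 - (cos \<theta>)\<^sup>2" "(sin \<phi>)\<^sup>2 = 1 - (cos \<phi>)\<^sup>2"
      by (simp_all add: sin_squared_eq)
    then show ?thesis
      unfolding eval3_D_poly cos_add cos_diff by algebra
  qed
  show ?thesis
  proof
    assume v: "eval3 D_poly v = 0"
    obtain \<theta> \<phi> z where vz: "v = (2 * cos \<theta>, 2 * cos \<phi>, z)"
      using two_cos_surj by (metis prod.exhaust)
    then have "z = 2 * cos (\<theta> + \<phi>) \<or> z = 2 * cos (\<theta> + - \<phi>)"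
      using v D by simp
    then have "v = trig_point \<theta> \<phi> \<or> v = trig_point \<theta> (- \<phi>)"
      by (auto simp: vz trig_point_def)
    then show "\<exists>\<theta> \<phi>. v = trig_point \<theta> \<phi>" by blast
  next
    assume "\<exists>\<theta> \<phi>. v = trig_point \<theta> \<phi>"
    then show "eval3 D_poly v = 0"
      by (auto simp: trig_point_def D)
  qed
qed

definition torus :: "complex \<Rightarrow> complex^2^2" where
  "torus \<theta> = vector [vector [exp (\<i> * \<theta>), 0], vector [0, exp (- (\<i> * \<theta>))]]"

lemma torus_in_SL2: "torus \<theta> \<in> carrier SL2"
  by (simp add: torus_def SL2_def det_2 exp_minus)

lemma trace_torus: "trace (torus \<theta>) = 2 * cos \<theta>"
  by (simp add: torus_def trace_def sum_2 cos_exp_eq)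

lemma torus_mult: "torus \<theta> \<otimes>\<^bsub>SL2\<^esub> torus \<phi> = torus (\<theta> + \<phi>)"
  by (simp add: torus_def SL2_def vec_eq_iff forall_2 matrix_matrix_mult_def sum_2 exp_add[symmetric] algebra_simps)

lemma torus_zero: "torus 0 = \<one>\<^bsub>SL2\<^esub>"
  by (simp add: torus_def SL2_def vec_eq_iff forall_2 mat_def)

lemma torus_int_pow: "torus \<theta> [^]\<^bsub>SL2\<^esub> k = torus (of_int k * \<theta>)" for k :: int
proof -
  interpret SL2: group SL2 by (rule group_SL2)
  have inv: "inv\<^bsub>SL2\<^esub> torus \<theta> = torus (- \<theta>)"
    by (rule SL2.inv_equality) (simp_all add: torus_mult torus_zero torus_in_SL2)
  show ?thesis
  proof (induction k rule: int_induct[where k = 0])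
    case base
    then show ?case by (simp add: torus_zero)
  next
    case (step1 i)
    then show ?case
      using SL2.int_pow_mult[OF torus_in_SL2, of \<theta> i 1] SL2.int_pow_1[OF torus_in_SL2, of \<theta>]
      by (simp add: torus_mult algebra_simps)
  next
    case (step2 i)
    then show ?case
      using SL2.int_pow_diff[OF torus_in_SL2, of \<theta> i 1] SL2.int_pow_1[OF torus_in_SL2, of \<theta>]
      by (simp add: torus_mult inv algebra_simps)
  qed
qed

text \<open>The defining property of \<open>F\<^sub>a\<^sub>,\<^sub>b\<close>, applied to diagonal matrices; their powers multiply the angles.\<close>

lemma F_poly_trig_point: "eval3 (F_poly a b) (trig_point \<theta> \<phi>) = 2 * cos (of_int a * \<theta> - of_int b * \<phi>)"
proof -
  have "eval3 (F_poly a b) (trace (torus \<theta>), trace (torus \<phi>), trace (torus \<theta> \<otimes>\<^bsub>SL2\<^esub> torus \<phi>)) =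
    trace ((torus \<theta> [^]\<^bsub>SL2\<^esub> a) \<otimes>\<^bsub>SL2\<^esub> (torus \<phi> [^]\<^bsub>SL2\<^esub> (- b)))"
    using F_poly[of a b] torus_in_SL2 unfolding is_trace_poly_def by blast
  then show ?thesis
    by (simp add: torus_int_pow torus_mult trace_torus trig_point_def)
qed

definition reducible_curve :: "int \<Rightarrow> int \<Rightarrow> complex \<Rightarrow> point3 set" where
  "reducible_curve p q c = {v. eval3 D_poly v = 0 \<and> eval3 (F_poly p q) v = c}"

text \<open>The right-hand side runs through all \<open>(\<theta>, \<phi>)\<close> with \<open>p\<theta> - q\<phi> = \<psi>\<close>. A point of the curve only satisfies
  this up to sign and up to a multiple of \<open>2\<pi>\<close>. The sign is removed by negating both angles, and
  the multiple by adding multiples of \<open>2\<pi>\<close> to them, which can produce every integer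
  combination of \<open>p\<close> and \<open>q\<close>, hence every integer.\<close>

lemma reducible_curve_eq_range:
  assumes "coprime p q" "p \<noteq> 0"
  shows "reducible_curve p q (2 * cos \<psi>) =
    range (\<lambda>t. trig_point (of_int q * t + \<psi> / of_int p) (of_int p * t))"
proof (intro equalityI subsetI)
  fix v assume v: "v \<in> reducible_curve p q (2 * cos \<psi>)"
  have mem: "trig_point \<theta> \<phi> \<in> range (\<lambda>t. trig_point (of_int q * t + \<psi> / of_int p) (of_int p * t))"
    if j: "of_int p * \<theta> - of_int q * \<phi> = \<psi> + 2 * of_real pi * of_int j" for \<theta> \<phi> j
  proof -
    obtain u w where uw: "u * p + w * q = 1"
      using bezout_int[of p q] assms(1) by auto
    \<comment> \<open>The shifts change \<open>p\<theta> - q\<phi>\<close> by \<open>- 2\<pi>j(up + wq) = - 2\<pi>j\<close>.\<close>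
    define \<theta>' \<phi>' where "\<theta>' = \<theta> + 2 * of_real pi * of_int (- (u * j))"
      and "\<phi>' = \<phi> + 2 * of_real pi * of_int (w * j)"
    have "(of_int u * of_int p + of_int w * of_int q :: complex) = 1"
      using uw by (metis of_int_1 of_int_add of_int_mult)
    moreover have "of_int p * \<theta>' - of_int q * \<phi>' =
        (of_int p * \<theta> - of_int q * \<phi>) - 2 * of_real pi * of_int j * (of_int u * of_int p + of_int w * of_int q)"
      unfolding \<theta>'_def \<phi>'_def by (simp add: algebra_simps)
    ultimately have "of_int p * \<theta>' - of_int q * \<phi>' = \<psi>"
      using j by simp
    then have "of_int p * \<theta>' = of_int q * \<phi>' + \<psi>"
      by (simp add: diff_eq_eq add.commute)
    then have "\<theta>' = (of_int q * \<phi>' + \<psi>) / of_int p"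
      using assms(2) by (simp add: eq_divide_eq mult.commute)
    then have "\<theta>' = of_int q * (\<phi>' / of_int p) + \<psi> / of_int p" "\<phi>' = of_int p * (\<phi>' / of_int p)"
      using assms(2) by (simp_all add: add_divide_distrib)
    then have "trig_point \<theta>' \<phi>' = trig_point (of_int q * (\<phi>' / of_int p) + \<psi> / of_int p) (of_int p * (\<phi>' / of_int p))"
      by (simp only:)
    moreover have "trig_point \<theta> \<phi> = trig_point \<theta>' \<phi>'"
      unfolding \<theta>'_def \<phi>'_def trig_point_plus_2pi_int ..
    ultimately have eq: "trig_point \<theta> \<phi> = trig_point (of_int q * (\<phi>' / of_int p) + \<psi> / of_int p) (of_int p * (\<phi>' / of_int p))"
      by (simp only:)
    show ?thesis
      by (rule image_eqI[of _ _ "\<phi>' / of_int p"], rule eq, rule UNIV_I)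
  qed
  obtain \<theta> \<phi> where \<theta>\<phi>: "v = trig_point \<theta> \<phi>"
    using v D_poly_zero_iff[of v] unfolding reducible_curve_def by blast
  then have "cos (of_int p * \<theta> - of_int q * \<phi>) = cos \<psi>"
    using v by (simp add: reducible_curve_def F_poly_trig_point)
  then show "v \<in> range (\<lambda>t. trig_point (of_int q * t + \<psi> / of_int p) (of_int p * t))"
  proof (cases rule: cos_eq_cos_cases)
    case (1 j)
    then show ?thesis unfolding \<theta>\<phi> by (rule mem)
  next
    case (2 j)
    have "of_int p * (- \<theta>) - of_int q * (- \<phi>) = - (of_int p * \<theta> - of_int q * \<phi>)"
      by simp
    also have "\<dots> = \<psi> + 2 * of_real pi * of_int (- j)"
      unfolding 2 by simp
    finally have "of_int p * (- \<theta>) - of_int q * (- \<phi>) = \<psi> + 2 * of_real pi * of_int (- j)" .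
    then show ?thesis
      using mem unfolding \<theta>\<phi> by (metis trig_point_minus)
  qed
next
  fix v assume "v \<in> range (\<lambda>t. trig_point (of_int q * t + \<psi> / of_int p) (of_int p * t))"
  then obtain t where v: "v = trig_point (of_int q * t + \<psi> / of_int p) (of_int p * t)" by blast
  have "of_int p * (of_int q * t + \<psi> / of_int p) - of_int q * (of_int p * t) = \<psi>"
    using assms(2) by (simp add: algebra_simps)
  then show "v \<in> reducible_curve p q (2 * cos \<psi>)"
    unfolding v reducible_curve_def F_poly_trig_point mem_Collect_eq D_poly_zero_iff by auto
qed

lemma irreducible_reducible_curve:
  assumes "coprime p q" "p \<noteq> 0"
  shows "irreducible_set (reducible_curve p q c)"
proof -
  obtain \<psi> where c: "c = 2 * cos \<psi>" using two_cos_surj by blast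
  have "reducible_curve p q c = zero_set {D_poly, F_poly p q - const3 c}"
    by (auto simp: reducible_curve_def zero_set_def)
  then have "algebraic_set (reducible_curve p q c)"
    unfolding algebraic_set_def by blast
  then show ?thesis
    unfolding c
    by (intro irreducible_range_entire[OF _ _ _ reducible_curve_eq_range[OF assms, unfolded trig_point_def]])
      (auto intro!: holomorphic_intros simp: assms)
qed

definition vertical_line :: "complex \<Rightarrow> complex \<Rightarrow> point3 set" where
  "vertical_line a b = {(x, y, z). x = a \<and> y = b}"

lemma irreducible_vertical_line: "irreducible_set (vertical_line a b)"
proof -
  have "vertical_line a b = zero_set {varX - const3 a, varY - const3 b}"
    by (auto simp: vertical_line_def zero_set_def)
  then have "algebraic_set (vertical_line a b)"
    unfolding algebraic_set_def by blast
  then show ?thesis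
    by (intro irreducible_range_entire[of "\<lambda>_. a" "\<lambda>_. b" "\<lambda>t. t"])
      (auto intro!: holomorphic_intros simp: vertical_line_def)
qed

text \<open>On a vertical line, \<open>D\<close> is a monic quadratic polynomial in \<open>z\<close>, so its second difference is \<open>2\<close>; on
  the curve, \<open>D\<close> vanishes.\<close>

lemma vertical_line_not_subset_reducible_curve: "\<not> vertical_line a b \<subseteq> reducible_curve p q c"
proof
  assume sub: "vertical_line a b \<subseteq> reducible_curve p q c"
  have D: "a\<^sup>2 + b\<^sup>2 + z\<^sup>2 - a * b * z - 4 = 0" for z
  proof -
    have "(a, b, z) \<in> reducible_curve p q c"
      using sub by (auto simp: vertical_line_def)
    then show ?thesis
      by (simp add: reducible_curve_def eval3_D_poly)
  qed
  have "(2::complex) = (a\<^sup>2 + b\<^sup>2 + 1\<^sup>2 - a * b * 1 - 4)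
      + (a\<^sup>2 + b\<^sup>2 + (- 1)\<^sup>2 - a * b * (- 1) - 4) - 2 * (a\<^sup>2 + b\<^sup>2 + 0\<^sup>2 - a * b * 0 - 4)"
    by simp
  also have "\<dots> = 0"
    unfolding D by simp
  finally show False by simp
qed

text \<open>As \<open>q \<noteq> 0\<close>, the angle \<open>\<theta>\<close> takes the values \<open>0\<close> and \<open>\<pi>\<close> along the curve, so the first
  coordinate is not constant.\<close>

lemma reducible_curve_not_subset_vertical_line:
  assumes "coprime p q" "p \<noteq> 0" "q \<noteq> 0"
  shows "\<not> reducible_curve p q c \<subseteq> vertical_line a b"
proof
  assume sub: "reducible_curve p q c \<subseteq> vertical_line a b"
  obtain \<psi> where c: "c = 2 * cos \<psi>" using two_cos_surj by blast
  have "2 * cos (of_int q * t + \<psi> / of_int p) = a" for t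
    using sub unfolding c reducible_curve_eq_range[OF assms(1,2)]
    by (auto simp: vertical_line_def trig_point_def)
  from this[of "- (\<psi> / of_int p) / of_int q"] this[of "(of_real pi - \<psi> / of_int p) / of_int q"]
  show False using assms(3) by auto
qed

lemma reducible_curve_subset_imp_eq:
  assumes "coprime p q" "p \<noteq> 0" "reducible_curve p q c \<subseteq> reducible_curve p q c'"
  shows "c = c'"
proof -
  have "reducible_curve p q c \<noteq> {}"
    using irreducible_reducible_curve[OF assms(1,2)] by (simp add: irreducible_set_def)
  then show ?thesis
    using assms(3) by (auto simp: reducible_curve_def)
qed

text \<open>On \<open>D = 0\<close> one has \<open>F\<^sub>d\<^sub>p\<^sub>,\<^sub>d\<^sub>q = f\<^sub>d(F\<^sub>p\<^sub>,\<^sub>q)\<close>, since both sides are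
  \<open>2 cos d(p\<theta> - q\<phi>)\<close>. So the condition \<open>F\<^sub>d\<^sub>p\<^sub>,\<^sub>d\<^sub>q = 2\<close> is a union of level sets of \<open>F\<^sub>p\<^sub>,\<^sub>q\<close>.\<close>

lemma F_poly_eq_2_on_reducible:
  "{v. eval3 D_poly v = 0 \<and> eval3 (F_poly (d * p) (d * q)) v = 2} =
    \<Union> (reducible_curve p q ` {c. poly (f_poly d) c = 2})"
proof -
  have "eval3 (F_poly (d * p) (d * q)) v = poly (f_poly d) (eval3 (F_poly p q) v)"
    if "eval3 D_poly v = 0" for v
  proof -
    obtain \<theta> \<phi> where v: "v = trig_point \<theta> \<phi>"
      using \<open>eval3 D_poly v = 0\<close> D_poly_zero_iff[of v] by blast
    show ?thesis
      unfolding v F_poly_trig_point f_poly_two_cos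
      by (simp only: of_int_mult right_diff_distrib mult.assoc)
  qed
  then show ?thesis
    by (auto simp: reducible_curve_def)
qed

text \<open>On \<open>D = 0\<close> the single generator \<open>F\<^sub>m\<^sub>,\<^sub>n - F\<^sub>0\<^sub>,\<^sub>0\<close> of \<open>J\<close> suffices: it makes \<open>m\<theta> - n\<phi>\<close> a multiple of
  \<open>2\<pi>\<close>, by which the angles in \<open>F\<^sub>i\<^sub>,\<^sub>k\<close> and \<open>F\<^sub>j\<^sub>,\<^sub>l\<close> differ.\<close>

lemma zero_set_I3_ideal:
  "zero_set (I3_ideal m n) = {v. eval3 D_poly v = 0 \<and> eval3 (F_poly m n) v = 2}"
proof -
  let ?G = "{F_poly i k - F_poly j l | i j k l. i - j = m \<and> k - l = n}"
  have I3: "zero_set (I3_ideal m n) = zero_set ?G \<inter> zero_set {D_poly}"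
    unfolding I3_ideal_def J_ideal_def by (rule zero_set_ideal_sum)
  have key: "(\<forall>p\<in>?G. eval3 p v = 0) \<longleftrightarrow> eval3 (F_poly m n) v = 2" if "eval3 D_poly v = 0" for v
  proof
    obtain \<theta> \<phi> where v: "v = trig_point \<theta> \<phi>"
      using \<open>eval3 D_poly v = 0\<close> D_poly_zero_iff[of v] by blast
    {
      assume "\<forall>p\<in>?G. eval3 p v = 0"
      moreover have "F_poly m n - F_poly 0 0 \<in> ?G"
        by (rule CollectI, rule exI[of _ m], rule exI[of _ 0], rule exI[of _ n], rule exI[of _ 0]) simp
      ultimately have "eval3 (F_poly m n - F_poly 0 0) v = 0" by blast
      then show "eval3 (F_poly m n) v = 2"
        by (simp add: v F_poly_trig_point)
    next
      assume "eval3 (F_poly m n) v = 2"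
      then have "cos (of_int m * \<theta> - of_int n * \<phi>) = 1"
        by (simp add: v F_poly_trig_point)
      then obtain r where r: "of_int m * \<theta> - of_int n * \<phi> = of_real (2 * of_int r * pi)"
        unfolding cos_eq_1 by auto
      show "\<forall>p\<in>?G. eval3 p v = 0"
      proof
        fix p assume "p \<in> ?G"
        then obtain i j k l where p: "p = F_poly i k - F_poly j l" and m: "m = i - j" and n: "n = k - l"
          by blast
        have "of_int i * \<theta> - of_int k * \<phi> = of_int j * \<theta> - of_int l * \<phi> + 2 * of_real pi * of_int r"
          using r unfolding m n by (simp add: algebra_simps)
        then show "eval3 p v = 0"
          by (simp add: p v F_poly_trig_point cos_plus_2pi_int)
      qed
    }
  qed
  show ?thesis
  proof (rule Set.set_eqI)
    fix v
    have eq: "v \<in> zero_set (I3_ideal m n) \<longleftrightarrow> (\<forall>p\<in>?G. eval3 p v = 0) \<and> eval3 D_poly v = 0"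
      unfolding I3 unfolding zero_set_def Int_iff mem_Collect_eq by simp
    show "v \<in> zero_set (I3_ideal m n) \<longleftrightarrow> v \<in> {v. eval3 D_poly v = 0 \<and> eval3 (F_poly m n) v = 2}"
    proof (cases "eval3 D_poly v = 0")
      case True
      then show ?thesis unfolding eq key[OF True] by simp
    next
      case False
      then show ?thesis unfolding eq by simp
    qed
  qed
qed

section \<open>Powers in SL(2, C)\<close>

lemma f_poly_square: "poly (f_poly (2 * m)) x = (poly (f_poly m) x)\<^sup>2 - 2"
proof -
  obtain \<theta> where x: "x = 2 * cos \<theta>" using two_cos_surj by blast
  have "cos (of_int (2 * m) * \<theta>) = 2 * (cos (of_int m * \<theta>))\<^sup>2 - 1"
    using cos_double_cos[of "of_int m * \<theta>"] by (simp add: mult.assoc)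
  then show ?thesis
    unfolding x f_poly_two_cos by (simp add: power_mult_distrib)
qed

text \<open>The polynomial \<open>s\<^sub>2\<^sub>m\<close> is the coefficient of \<open>A\<close> in \<open>A\<^sup>m\<close>, by \<open>SL2_int_pow_entry\<close>
  below, so its roots are the traces of non-central matrices with central \<open>m\<close>-th power.\<close>

lemma s_poly_double_root_iff:
  assumes "m \<noteq> 0"
  shows "poly (s_poly (2 * m)) x = 0 \<longleftrightarrow> (\<exists>E. x \<in> central_traces E m)"
proof -
  have "poly (f_poly (2 * m)) x = 2 \<longleftrightarrow> (poly (f_poly m) x)\<^sup>2 = 2\<^sup>2"
    by (simp add: f_poly_square diff_eq_eq)
  also have "\<dots> \<longleftrightarrow> poly (f_poly m) x = 2 \<or> poly (f_poly m) x = - 2"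
    by (rule power2_eq_iff)
  finally show ?thesis
    using assms by (auto simp: s_poly_root_iff central_traces_def ex_bool_eq)
qed

lemma f_poly_eq_s_poly:
  "poly (f_poly k) x = x * poly (s_poly (2 * k)) x - 2 * poly (s_poly (2 * k - 2)) x"
proof (induction k rule: int_two_step_induct)
  case 1
  then show ?case using s_poly_eval_rec(2)[of "- 2" x] by (simp add: f_poly_base s_poly_base)
next
  case 2
  then show ?case by (simp add: f_poly_base s_poly_base)
next
  case (3 k)
  have i: "2 * (k - 1) = 2 * k - 2" "2 * (k - 2) = 2 * k - 4" "2 * k - 2 - 2 = 2 * k - 4"
    "2 * k - 4 - 2 = 2 * k - 2 - 4" by simp_all
  show ?case
    unfolding f_poly_eval_rec(1)[of k] 3 i s_poly_eval_rec(1)[of "2 * k"] s_poly_eval_rec(1)[of "2 * k - 2"]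
    by algebra
next
  case (4 k)
  have i: "2 * (k + 1) = 2 * k + 2" "2 * (k + 2) = 2 * k + 4" "2 * k + 4 - 2 = 2 * k - 2 + 4"
    "2 * k + 2 - 2 = 2 * k - 2 + 2" by simp_all
  show ?case
    unfolding f_poly_eval_rec(2)[of k] 4 i s_poly_eval_rec(2)[of "2 * k"] s_poly_eval_rec(2)[of "2 * k - 2"]
    by algebra
qed

lemma SL2_int_pow_entry_rec:
  fixes k :: int
  assumes "A \<in> carrier SL2"
  shows "(A [^]\<^bsub>SL2\<^esub> k) $ i $ j = trace A * (A [^]\<^bsub>SL2\<^esub> (k - 1)) $ i $ j - (A [^]\<^bsub>SL2\<^esub> (k - 2)) $ i $ j"
proof -
  interpret SL2: group SL2 by (rule group_SL2)
  define P where "P = A [^]\<^bsub>SL2\<^esub> (k - 2)"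
  have 1: "A [^]\<^bsub>SL2\<^esub> (k - 1) = A ** P"
    using SL2.int_pow_mult[OF assms, of 1 "k - 2"] SL2.int_pow_1[OF assms]
    by (simp add: P_def) (simp add: SL2_def)
  have 2: "A [^]\<^bsub>SL2\<^esub> k = A ** (A [^]\<^bsub>SL2\<^esub> (k - 1))"
    using SL2.int_pow_mult[OF assms, of 1 "k - 1"] SL2.int_pow_1[OF assms]
    by simp (simp add: SL2_def)
  have det: "A$1$1 * A$2$2 - A$1$2 * A$2$1 = 1"
    using assms by (simp add: SL2_def det_2)
  have "\<forall>i j. (A ** (A ** P)) $ i $ j = trace A * (A ** P) $ i $ j - P $ i $ j"
    unfolding forall_2 using det
    by (intro conjI; simp add: matrix_matrix_mult_def sum_2 trace_def; algebra)
  then show ?thesis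
    unfolding 2 1 P_def[symmetric] by blast
qed

text \<open>By Cayley-Hamilton, both sides satisfy the recursion of \<open>s\<^sub>2\<^sub>k\<close> in \<open>k\<close>; at \<open>k = 0\<close> the right-hand
  side is \<open>I\<close> because \<open>s\<^sub>-\<^sub>2 = -1\<close>.\<close>

lemma SL2_int_pow_entry:
  assumes "A \<in> carrier SL2"
  shows "(A [^]\<^bsub>SL2\<^esub> k) $ i $ j =
    poly (s_poly (2 * k)) (trace A) * A $ i $ j - poly (s_poly (2 * k - 2)) (trace A) * mat 1 $ i $ j"
proof (induction k rule: int_two_step_induct)
  case 1
  then show ?case
    using s_poly_eval_rec(2)[of "- 2" "trace A"] by (simp add: s_poly_base) (simp add: SL2_def)
next
  case 2
  then show ?case
    using group.int_pow_1[OF group_SL2 assms] by (simp add: s_poly_base)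
next
  case (3 k)
  have i: "2 * (k - 1) = 2 * k - 2" "2 * (k - 2) = 2 * k - 4" "2 * k - 2 - 2 = 2 * k - 4"
    "2 * k - 4 - 2 = 2 * k - 2 - 4" by simp_all
  show ?case
    unfolding SL2_int_pow_entry_rec[OF assms, of k] 3 i
      s_poly_eval_rec(1)[of "2 * k"] s_poly_eval_rec(1)[of "2 * k - 2"]
    by algebra
next
  case (4 k)
  have i: "2 * (k + 1) = 2 * k + 2" "2 * (k + 2) = 2 * k + 4" "2 * k + 4 - 2 = 2 * k - 2 + 4"
    "2 * k + 2 - 2 = 2 * k - 2 + 2" by simp_all
  have i': "k + 2 - 1 = k + 1" "k + 2 - 2 = k" by simp_all
  have "(A [^]\<^bsub>SL2\<^esub> k) $ i $ j = trace A * (A [^]\<^bsub>SL2\<^esub> (k + 1)) $ i $ j - (A [^]\<^bsub>SL2\<^esub> (k + 2)) $ i $ j"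
    using SL2_int_pow_entry_rec[OF assms, of "k + 2" i j] unfolding i' by algebra
  then show ?case
    unfolding 4 i s_poly_eval_rec(2)[of "2 * k"] s_poly_eval_rec(2)[of "2 * k - 2"]
    by algebra
qed

text \<open>The coefficient of \<open>A\<close> in \<open>A\<^sup>m\<close> vanishes, and the remaining scalar is half of the trace
  \<open>f\<^sub>m(tr A) = \<plusminus>2\<close> of \<open>A\<^sup>m\<close>.\<close>

lemma SL2_int_pow_central:
  assumes "A \<in> carrier SL2" "trace A \<in> central_traces E m" "m \<noteq> 0"
  shows "A [^]\<^bsub>SL2\<^esub> m = mat (if E then 1 else - 1)"
proof -
  have s: "poly (s_poly (2 * m)) (trace A) = 0"
    using assms s_poly_double_root_iff by blast
  then have "2 * - poly (s_poly (2 * m - 2)) (trace A) = 2 * (if E then 1 else - 1)"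
    using f_poly_eq_s_poly[of m "trace A"] assms(2) by (auto simp: central_traces_def split: if_splits)
  then have "- poly (s_poly (2 * m - 2)) (trace A) = (if E then 1 else - 1)"
    by (simp only: mult_cancel_left) simp
  then show ?thesis
    using SL2_int_pow_entry[OF assms(1), of m] s by (simp add: vec_eq_iff mat_def) 
qed

text \<open>A matrix \<open>A = \<alpha>B + \<beta>I\<close> commutes with \<open>B\<close>, and \<open>D\<close> is the trace of the commutator minus \<open>2\<close>.\<close>

lemma D_poly_zero_if_affine:
  assumes "A \<in> carrier SL2" "B \<in> carrier SL2"
    and "\<And>i j. A $ i $ j = \<alpha> * B $ i $ j + \<beta> * mat 1 $ i $ j"
  shows "eval3 D_poly (trace A, trace B, trace (A ** B)) = 0"
proof -
  have e: "A$1$1 = \<alpha> * B$1$1 + \<beta>" "A$1$2 = \<alpha> * B$1$2" "A$2$1 = \<alpha> * B$2$1" "A$2$2 = \<alpha> * B$2$2 + \<beta>"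
    by (simp_all add: assms(3) mat_def)
  have d: "A$1$1 * A$2$2 - A$1$2 * A$2$1 = 1" "B$1$1 * B$2$2 - B$1$2 * B$2$1 = 1"
    using assms(1,2) by (simp_all add: SL2_def det_2)
  show ?thesis
    using d unfolding eval3_D_poly trace_def matrix_matrix_mult_def sum_2
    by (simp add: e) algebra
qed

text \<open>Both sides of \<open>A\<^sup>m = B\<^sup>n\<close> are affine in \<open>A\<close> and in \<open>B\<close>. If the coefficient of \<open>A\<close> were nonzero, \<open>A\<close>
  would be affine in \<open>B\<close> and \<open>D\<close> would vanish.\<close>

lemma central_traces_if_irreducible:
  fixes m n :: int
  assumes A: "A \<in> carrier SL2" and B: "B \<in> carrier SL2" and "m \<noteq> 0"
    and eq: "A [^]\<^bsub>SL2\<^esub> m = B [^]\<^bsub>SL2\<^esub> n"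
    and D: "eval3 D_poly (trace A, trace B, trace (A ** B)) \<noteq> 0"
  shows "\<exists>E. trace A \<in> central_traces E m"
proof -
  define u w u' w' where "u = poly (s_poly (2 * m)) (trace A)" "w = poly (s_poly (2 * m - 2)) (trace A)"
    "u' = poly (s_poly (2 * n)) (trace B)" "w' = poly (s_poly (2 * n - 2)) (trace B)"
  have e: "u * A $ i $ j - w * mat 1 $ i $ j = u' * B $ i $ j - w' * mat 1 $ i $ j" for i j
    using SL2_int_pow_entry[OF A, of m i j] SL2_int_pow_entry[OF B, of n i j] eq
    unfolding u_w_u'_w'_def by simp
  have "u = 0"
  proof (rule ccontr)
    assume u: "u \<noteq> 0"
    have "A $ i $ j = (u' / u) * B $ i $ j + ((w - w') / u) * mat 1 $ i $ j" for i j
    proof -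
      have "u * A $ i $ j = u' * B $ i $ j + (w - w') * mat 1 $ i $ j"
        using e[of i j] by (simp add: algebra_simps)
      then have "A $ i $ j = (u' * B $ i $ j + (w - w') * mat 1 $ i $ j) / u"
        using u by (simp add: eq_divide_eq mult.commute)
      then show ?thesis
        by (simp add: add_divide_distrib)
    qed
    with A B D show False
      using D_poly_zero_if_affine by blast
  qed
  then show ?thesis
    using s_poly_double_root_iff[OF \<open>m \<noteq> 0\<close>] unfolding u_w_u'_w'_def by blast
qed

section \<open>Lines and curves in the character variety\<close>

definition line_parameters :: "int \<Rightarrow> int \<Rightarrow> (complex \<times> complex) set" where
  "line_parameters m n = (\<Union>E. central_traces E m \<times> central_traces E n)"

lemma vertical_line_subset_iff: "vertical_line a b \<subseteq> vertical_line a' b' \<longleftrightarrow> a = a' \<and> b = b'"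
  by (auto simp: vertical_line_def)

text \<open>Off \<open>D = 0\<close> both powers are central, with the same sign because they are equal. Conversely,
  every point on one of the lines is realised by some pair of matrices, since all triples are, and
  their powers are central with equal sign. On \<open>D = 0\<close> the equation \<open>F\<^sub>m\<^sub>,\<^sub>n = 2\<close> is
  necessary because \<open>A\<^sup>mB\<^sup>-\<^sup>n = I\<close>, and sufficient because diagonal matrices realise it.\<close>

lemma char_variety_decomposition:
  assumes "m \<noteq> 0" "n \<noteq> 0"
  shows "char_variety m n = (\<Union>(a, b)\<in>line_parameters m n. vertical_line a b) \<union>
    {v. eval3 D_poly v = 0 \<and> eval3 (F_poly m n) v = 2}"
proof -
  interpret SL2: group SL2 by (rule group_SL2)
  have mult: "(\<otimes>\<^bsub>SL2\<^esub>) = (**)" by (simp add: SL2_def)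
  show ?thesis
  proof (intro equalityI subsetI)
    fix v assume "v \<in> char_variety m n"
    then obtain A B where A: "A \<in> carrier SL2" and B: "B \<in> carrier SL2"
      and eq: "A [^]\<^bsub>SL2\<^esub> m = B [^]\<^bsub>SL2\<^esub> n" and v: "v = (trace A, trace B, trace (A ** B))"
      unfolding char_variety_eq mult by blast
    show "v \<in> (\<Union>(a, b)\<in>line_parameters m n. vertical_line a b) \<union>
        {v. eval3 D_poly v = 0 \<and> eval3 (F_poly m n) v = 2}"
    proof (cases "eval3 D_poly v = 0")
      case True
      have "eval3 (F_poly m n) v = trace (A [^]\<^bsub>SL2\<^esub> m \<otimes>\<^bsub>SL2\<^esub> B [^]\<^bsub>SL2\<^esub> (- n))"
        using F_poly[of m n] A B unfolding is_trace_poly_def v mult by blast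
      also have "A [^]\<^bsub>SL2\<^esub> m \<otimes>\<^bsub>SL2\<^esub> B [^]\<^bsub>SL2\<^esub> (- n) = \<one>\<^bsub>SL2\<^esub>"
        using B by (simp add: eq SL2.int_pow_neg)
      also have "trace \<one>\<^bsub>SL2\<^esub> = 2"
        by (simp add: SL2_def trace_I)
      finally show ?thesis using True by simp
    next
      case False
      have D: "eval3 D_poly (trace A, trace B, trace (A ** B)) \<noteq> 0"
        using False v by simp
      then have D': "eval3 D_poly (trace B, trace A, trace (B ** A)) \<noteq> 0"
        using trace_mul_sym[of A B] unfolding eval3_D_poly by (simp add: algebra_simps)
      obtain E where E: "trace A \<in> central_traces E m"
        using central_traces_if_irreducible[OF A B assms(1) eq D] by blast
      obtain E' where E': "trace B \<in> central_traces E' n"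
        using central_traces_if_irreducible[OF B A assms(2) eq[symmetric] D'] by blast
      have mat: "(mat (if E then 1 else - 1) :: complex^2^2) = mat (if E' then 1 else - 1)"
        using SL2_int_pow_central[OF A E assms(1)] SL2_int_pow_central[OF B E' assms(2)] eq by simp
      have "E = E'"
        using arg_cong[OF mat, of "\<lambda>M. M $ 1 $ 1"] by (auto simp: mat_def split: if_splits)
      then show ?thesis
        using E E' by (auto simp: line_parameters_def vertical_line_def v)
    qed
  next
    fix v assume "v \<in> (\<Union>(a, b)\<in>line_parameters m n. vertical_line a b) \<union>
        {v. eval3 D_poly v = 0 \<and> eval3 (F_poly m n) v = 2}"
    then consider (line) E x y z where "v = (x, y, z)" "x \<in> central_traces E m" "y \<in> central_traces E n"
      | (curve) "eval3 D_poly v = 0" "eval3 (F_poly m n) v = 2"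
      by (auto simp: line_parameters_def vertical_line_def)
    then show "v \<in> char_variety m n"
    proof cases
      case line
      obtain A B where AB: "A \<in> carrier SL2" "B \<in> carrier SL2"
        and tr: "(trace A, trace B, trace (A \<otimes>\<^bsub>SL2\<^esub> B)) = (x, y, z)"
        using trace_surj by blast
      then have "A [^]\<^bsub>SL2\<^esub> m = B [^]\<^bsub>SL2\<^esub> n"
        using SL2_int_pow_central[of A E m] SL2_int_pow_central[of B E n] line assms by simp
      then show ?thesis
        unfolding char_variety_eq line(1) tr[symmetric] using AB by blast
    next
      case curve
      then obtain \<theta> \<phi> where v: "v = trig_point \<theta> \<phi>"
        using D_poly_zero_iff[of v] by blast
      with curve have "cos (of_int m * \<theta> - of_int n * \<phi>) = 1"
        by (simp add: F_poly_trig_point)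
      then obtain r where "of_int m * \<theta> - of_int n * \<phi> = of_real (2 * of_int r * pi)"
        unfolding cos_eq_1 by auto
      then have r: "of_int m * \<theta> = of_int n * \<phi> + 2 * of_int r * of_real pi"
        by (simp add: diff_eq_eq add.commute)
      have e: "exp (\<i> * (of_int m * \<theta>)) = exp (\<i> * (of_int n * \<phi>))"
        unfolding r exp_eq by (intro exI[of _ r]) (simp add: algebra_simps)
      have "torus \<theta> [^]\<^bsub>SL2\<^esub> m = torus \<phi> [^]\<^bsub>SL2\<^esub> n"
        unfolding torus_int_pow unfolding torus_def exp_minus e ..
      moreover have "v = (trace (torus \<theta>), trace (torus \<phi>), trace (torus \<theta> \<otimes>\<^bsub>SL2\<^esub> torus \<phi>))"
        by (simp add: v trig_point_def trace_torus torus_mult)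
      ultimately show ?thesis
        unfolding char_variety_eq using torus_in_SL2 by blast
    qed
  qed
qed

lemma zero_set_I1_I2_ideals:
  assumes "m \<noteq> 0" "n \<noteq> 0"
  shows "zero_set (I1_ideal m n) \<union> zero_set (I2_ideal m n) =
    (\<Union>(a, b)\<in>line_parameters m n. vertical_line a b)"
proof -
  have I1: "zero_set (I1_ideal m n) = (\<Union>(a, b)\<in>central_traces True m \<times> central_traces True n. vertical_line a b)"
    unfolding I1_ideal_def zero_set_ideal_gen using assms
    by (auto simp: zero_set_def eval3_subst3 s_poly_root_iff central_traces_def vertical_line_def)
  have I2: "zero_set (I2_ideal m n) = (\<Union>(a, b)\<in>central_traces False m \<times> central_traces False n. vertical_line a b)"
  proof -
    have "v \<in> zero_set (I2_ideal m n) \<longleftrightarrow>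
      poly (if odd m then sigma_poly m else f_poly (m div 2)) (eval3 varX v) = 0 \<and>
      poly (if odd n then sigma_poly n else f_poly (n div 2)) (eval3 varY v) = 0" for v
      unfolding I2_ideal_def zero_set_ideal_gen by (simp add: zero_set_def eval3_subst3 del: eval3_simps(1,2))
    then show ?thesis
      unfolding sigma_f_poly_root_iff[OF assms(1)] sigma_f_poly_root_iff[OF assms(2)]
      by (auto simp: central_traces_def vertical_line_def)
  qed
  show ?thesis
    unfolding I1 I2 line_parameters_def by (auto simp: UNIV_bool)
qed

lemma card_line_parameters:
  assumes "m \<noteq> 0" "n \<noteq> 0"
  shows "finite (line_parameters m n)"
    "int (card (line_parameters m n)) =
      ((\<bar>m\<bar> - 1) div 2) * ((\<bar>n\<bar> - 1) div 2) + (\<bar>m\<bar> div 2) * (\<bar>n\<bar> div 2)"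
proof -
  have eq: "line_parameters m n =
      central_traces True m \<times> central_traces True n \<union> central_traces False m \<times> central_traces False n"
    by (auto simp: line_parameters_def UNIV_bool)
  have fin: "finite (central_traces E m \<times> central_traces E n)" for E
    using card_central_traces(1)[OF assms(1)] card_central_traces(1)[OF assms(2)] by blast
  then show "finite (line_parameters m n)" unfolding eq by blast
  have "central_traces True m \<times> central_traces True n \<inter> central_traces False m \<times> central_traces False n = {}"
    by (auto simp: central_traces_def)
  then have "card (line_parameters m n) =
      card (central_traces True m \<times> central_traces True n) + card (central_traces False m \<times> central_traces False n)"
    unfolding eq using fin by (intro card_Un_disjoint)
  then show "int (card (line_parameters m n)) =
      ((\<bar>m\<bar> - 1) div 2) * ((\<bar>n\<bar> - 1) div 2) + (\<bar>m\<bar> div 2) * (\<bar>n\<bar> div 2)"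
    using card_central_traces(2)[OF assms(1)] card_central_traces(2)[OF assms(2)]
    by (simp add: card_cartesian_product)
qed

text \<open>The number of pairs of integers strictly between \<open>0\<close> and \<open>M\<close>, respectively \<open>N\<close>, with equal parity: half
  of all pairs, rounded up when both numbers are even and the corner pairs are both odd.\<close>

lemma half_products:
  fixes M N :: int
  shows "real_of_int (((M - 1) div 2) * ((N - 1) div 2) + (M div 2) * (N div 2)) =
    (if odd M \<or> odd N then real_of_int ((M - 1) * (N - 1)) / 2
     else real_of_int ((M - 1) * (N - 1) + 1) / 2)"
proof -
  have div: "(2 * a) div 2 = a" "(2 * a + 1) div 2 = a" "(a * 2 - 1) div 2 = a - 1" for a :: int
    by simp_all
  obtain a where "M = 2 * a \<or> M = 2 * a + 1" by (metis evenE oddE)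
  moreover obtain b where "N = 2 * b \<or> N = 2 * b + 1" by (metis evenE oddE)
  ultimately show ?thesis
    by (elim disjE) (simp_all add: div algebra_simps add_divide_distrib diff_divide_distrib)
qed

theorem theorem4p9:
  fixes m n d :: int
  assumes "m \<noteq> 0" and "n \<noteq> 0" and "d = gcd m n"
  shows "(finite (irreducible_components (char_variety m n)) \<and>
     real (card (irreducible_components (char_variety m n))) =
       (if odd d
        then real_of_int ((\<bar>m\<bar> - 1) * (\<bar>n\<bar> - 1)) / 2 + real_of_int (d + 1) / 2
        else real_of_int ((\<bar>m\<bar> - 1) * (\<bar>n\<bar> - 1) + 1) / 2 + real_of_int (d + 2) / 2)) \<and>
     (finite (straight_lines (zero_set (I1_ideal m n) \<union> zero_set (I2_ideal m n))) \<and>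
     real (card (straight_lines (zero_set (I1_ideal m n) \<union> zero_set (I2_ideal m n)))) =
       (if odd d
        then real_of_int ((\<bar>m\<bar> - 1) * (\<bar>n\<bar> - 1)) / 2
        else real_of_int ((\<bar>m\<bar> - 1) * (\<bar>n\<bar> - 1) + 1) / 2)) \<and>
     (finite (irreducible_components (zero_set (I3_ideal m n))) \<and>
     real (card (irreducible_components (zero_set (I3_ideal m n)))) =
       (if odd d then real_of_int (d + 1) / 2 else real_of_int (d + 2) / 2))"
proof -
  have d: "0 < d" using assms by simp
  define p q where "p = m div d" and "q = n div d"
  have m: "m = d * p" and n: "n = d * q"
    by (simp_all add: p_def q_def assms(3))
  have cop: "coprime p q"
    unfolding p_def q_def assms(3) using assms(1) by (intro div_gcd_coprime) simp
  have p: "p \<noteq> 0" using assms(1) m by (metis mult_zero_right)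
  have q: "q \<noteq> 0" using assms(2) n by (metis mult_zero_right)
  define L where "L = (\<lambda>(a, b). vertical_line a b) ` line_parameters m n"
  define C where "C = reducible_curve p q ` {c. poly (f_poly d) c = 2}"

  have finL: "finite L"
    using card_line_parameters(1)[OF assms(1,2)] by (simp add: L_def)
  have finC: "finite C"
    using card_f_poly_solutions(1)[OF d] by (simp add: C_def)
  have irrL: "irreducible_set F" if "F \<in> L" for F
    using that irreducible_vertical_line by (auto simp: L_def)
  have irrC: "irreducible_set F" if "F \<in> C" for F
    using that irreducible_reducible_curve[OF cop p] by (auto simp: C_def)
  have antiL: "F = G" if "F \<in> L" "G \<in> L" "F \<subseteq> G" for F G
    using that by (auto simp: L_def vertical_line_subset_iff)
  have antiC: "F = G" if "F \<in> C" "G \<in> C" "F \<subseteq> G" for F G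
    using that reducible_curve_subset_imp_eq[OF cop p] unfolding C_def by blast
  have notLC: "\<not> F \<subseteq> G" if "F \<in> L" "G \<in> C" for F G
    using that vertical_line_not_subset_reducible_curve unfolding L_def C_def by fast
  have notCL: "\<not> F \<subseteq> G" if "F \<in> C" "G \<in> L" for F G
    using that reducible_curve_not_subset_vertical_line[OF cop p q] unfolding L_def C_def by fast

  have compL: "irreducible_components (\<Union>L) = L"
    by (rule irreducible_components_Union[OF finL irrL antiL])
  have compC: "irreducible_components (\<Union>C) = C"
    by (rule irreducible_components_Union[OF finC irrC antiC])
  have compLC: "irreducible_components (\<Union>(L \<union> C)) = L \<union> C"
  proof (rule irreducible_components_Union)
    fix F G assume "F \<in> L \<union> C" "G \<in> L \<union> C" "F \<subseteq> G"
    then show "F = G" using antiL[of F G] antiC[of F G] notLC[of F G] notCL[of F G] by blast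
  qed (use finL finC irrL irrC in auto)

  have I3: "zero_set (I3_ideal m n) = \<Union>C"
    unfolding zero_set_I3_ideal C_def F_poly_eq_2_on_reducible[symmetric] m n ..
  have I12: "zero_set (I1_ideal m n) \<union> zero_set (I2_ideal m n) = \<Union>L"
    unfolding zero_set_I1_I2_ideals[OF assms(1,2)] L_def ..
  have X: "char_variety m n = \<Union>(L \<union> C)"
    unfolding char_variety_decomposition[OF assms(1,2)] zero_set_I3_ideal[symmetric] I3
    by (simp add: L_def)
  have lines: "straight_lines (\<Union>L) = L"
    unfolding straight_lines_def compL by (auto simp: L_def vertical_line_def)

  have "inj_on (\<lambda>(a, b). vertical_line a b) (line_parameters m n)"
    by (rule inj_onI) (auto simp: vertical_line_def)
  then have "card L = card (line_parameters m n)"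
    unfolding L_def by (rule card_image)
  then have "real (card L) = real_of_int (((\<bar>m\<bar> - 1) div 2) * ((\<bar>n\<bar> - 1) div 2) + (\<bar>m\<bar> div 2) * (\<bar>n\<bar> div 2))"
    by (simp only: card_line_parameters(2)[OF assms(1,2), symmetric] of_int_of_nat_eq)
  moreover have "odd \<bar>m\<bar> \<or> odd \<bar>n\<bar> \<longleftrightarrow> odd d"
    by (simp add: assms(3))
  ultimately have cardL: "real (card L) =
      (if odd d then real_of_int ((\<bar>m\<bar> - 1) * (\<bar>n\<bar> - 1)) / 2
       else real_of_int ((\<bar>m\<bar> - 1) * (\<bar>n\<bar> - 1) + 1) / 2)"
    unfolding half_products by simp

  have "inj_on (reducible_curve p q) {c. poly (f_poly d) c = 2}"
    using reducible_curve_subset_imp_eq[OF cop p] by (intro inj_onI) simp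
  then have "int (card C) = d div 2 + 1"
    using card_f_poly_solutions(2)[OF d] by (simp add: C_def card_image)
  then have "2 * int (card C) = (if odd d then d + 1 else d + 2)"
    by presburger
  then have "2 * real (card C) = real_of_int (if odd d then d + 1 else d + 2)"
    by (simp only: flip: of_int_eq_iff[where 'a = real])
  then have cardC: "real (card C) = (if odd d then real_of_int (d + 1) / 2 else real_of_int (d + 2) / 2)"
    by (auto split: if_splits)

  have "L \<inter> C = {}" using notLC by blast
  then have cardLC: "card (L \<union> C) = card L + card C"
    using finL finC by (intro card_Un_disjoint)
  show ?thesis
    unfolding X I12 I3 lines compLC compC
    using finL finC cardL cardC by (simp add: cardLC)
qed

end
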